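(* Let $i\in\{1,2,3,4\}$ and consider the map $F_i$, with $a>1$ if $i\in\{1,2,3\}$ and $a<-1$ if $i=4$. If $g(\theta)\ge0$ for all $\theta\in\mathbb T$, then the family of curves $\{\varphi_\infty(b)\}_{0<b<b^*(a)}$ fractalizes as $b\to b^*(a)$ from below, i.e., $$\limsup_{b\to b^*(a)^-}L\big(\varphi_\infty(b)|_I\big)=+\infty$$ for every (nondegenerate) interval $I\subset\mathbb T$.
   Context: Maps. $\mathbb T=\mathbb R/2\pi\mathbb Z$, $\omega\notin 2\pi\mathbb Q$, and $g:\mathbb T\to\mathbb R$ is of class $C^{1+\tau}$ for some $\tau>0$. For $i=1,2,3,4$, $F_i:\mathbb R\times\mathbb T\to\mathbb R\times\mathbb T$ is $F_i(x,\theta)=(h_i(x)+\sigma_i b\,g(\theta),\ \theta+\omega)$ with $\sigma_1=\sigma_4=-1$, $\sigma_2=\sigma_3=1$, and - $h_1(x)=-\frac{\pi}{2}$ if $x<-\frac{\pi}{2a}$, $h_1(x)=ax$ if $|x|\le\frac{\pi}{2a}$, $h_1(x)=\frac{\pi}{2}$ if $x>\frac{\pi}{2a}$; - $h_2(x)=a(x+\delta)$ if $x<-\delta$, $h_2(x)=0$ if $|x|\le\delta$, $h_2(x)=a(x-\delta)$ if $x>\delta$ (here $\delta>0$ is fixed); - $h_3(x)=ax$ if $x>-\frac1a$, $h_3(x)=-1$ if $x\le-\frac1a$; - $h_4(x)=ax$ if $x>\frac1a$, $h_4(x)=1$ if $x\le\frac1a$. Put $\mathcal F_i(\varphi)(\theta)=h_i(\varphi(\theta-\omega))+\sigma_i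 b\,g(\theta-\omega)$ for $\varphi:\mathbb T\to\mathbb R$. Curves. $\mu_i$ is the continuous solution of: $\mu_1(\theta+\omega)=a\mu_1(\theta)-bg(\theta)$; $\mu_2(\theta+\omega)=a(\mu_2(\theta)-\delta)+bg(\theta)$; $\mu_3(\theta+\omega)=a\mu_3(\theta)+bg(\theta)$; $\mu_4(\theta+\omega)=a\mu_4(\theta)-bg(\theta)$. Also $\hat\mu_2$ is the continuous solution of $\hat\mu_2(\theta+\omega)=a(\hat\mu_2(\theta)+\delta)+bg(\theta)$ and $\tilde\gamma_1(\theta)=-\frac\pi2-bg(\theta-\omega)$. The initial curve $\varphi_0$ is: $\frac\pi2-bg(\theta-\omega)$ for $i=1$; $bg(\theta-\omega)$ for $i=2$; $-1+bg(\theta-\omega)$ for $i=3$; $1-bg(\theta-\omega)$ for $i=4$. For $n\ge0$, $\varphi_{n+1}=\mathcal F_i(\varphi_n)$ if $i=1,2,3$ and $\varphi_{n+1}=\mathcal F_4^2(\varphi_n)$ if $i=4$; $\varphi_\infty(b)=\lim_n\varphi_n$ (pointwise) for the given parameter $b$. Put $\lambda_0=\varphi_0-\mu_i$ if $i=1,4$ and $\lambda_0=\mu_i-\varphi_0$ if $i=2,3$. For a real function $f$ on an interval (or on $\mathbb T$), $L(f)=\sup_{x\ne y}|f(x)-f(y)|/|x-y|\in[0,+\infty]$ is its smallest Lipschitz constant. Bifurcation value. $b^*(a)$ (assumed to exist) is the smallest $b>0$ for which the following graphs meet: for $i=1$, the graph of $\mu_1$ and the graph of $\varphi_0$ or of $\tilde\gamma_1$;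 for $i=2$, the graph of $\varphi_0$ and the graph of $\mu_2$ or of $\hat\mu_2$; for $i=3,4$, the graphs of $\varphi_0$ and $\mu_i$. Standing assumption. At least one of the following holds: (A) $g$ is analytic; (B) for $b=b^*(a)$, for every $\theta_0$ with $\lambda_0(\theta_0)=0$ there exist $\varepsilon>0$ and an even integer $m>0$ such that $\lambda_0(\theta)=(\theta-\theta_0)^m q(\theta)$ for $\theta\in(\theta_0-\varepsilon,\theta_0+\varepsilon)$, with $q>0$ on this interval.
   Formalization: In (A), g is assumed analytic and not constant (for constant g > 0 every curve φ_∞(b) is constant, so L = 0 and the claim fails); in (B), q is taken to be continuous on the interval, without which (B) would only say that the zeros of λ_0 are isolated. *)

theory Defs
  imports "HOL-Analysis.Analysis"
begin

text \<open>
  The circle \<open>\<real>/2\<pi>\<int>\<close> is handled through its universal cover: a function on it is a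
  \<open>2\<pi>\<close>-periodic function on the reals, and an arc is lifted to an interval of the real line.
\<close>

definition circle_fun :: "(real \<Rightarrow> real) \<Rightarrow> bool" where
  "circle_fun f \<longleftrightarrow> (\<forall>\<theta>. f (\<theta> + 2 * pi) = f \<theta>)"

text \<open>
  Class \<open>C\<^sup>r\<close> for real \<open>r \<ge> 0\<close>: the derivatives up to order \<open>\<lfloor>r\<rfloor>\<close> exist, and the last one is
  continuous and Hoelder with exponent \<open>r - \<lfloor>r\<rfloor>\<close>. For integer \<open>r\<close> the last clause only says
  that this derivative has bounded oscillation, which is automatic for periodic functions.
\<close>

definition holder_class :: "real \<Rightarrow> (real \<Rightarrow> real) \<Rightarrow> bool" where
  "holder_class r f \<longleftrightarrow>
     (\<forall>k < nat \<lfloor>r\<rfloor>. \<forall>x. (deriv ^^ k) f differentiable (at x)) \<and>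
     continuous_on UNIV ((deriv ^^ nat \<lfloor>r\<rfloor>) f) \<and>
     (\<exists>C. \<forall>x y. \<bar>(deriv ^^ nat \<lfloor>r\<rfloor>) f x - (deriv ^^ nat \<lfloor>r\<rfloor>) f y\<bar>
                 \<le> C * \<bar>x - y\<bar> powr (r - of_int \<lfloor>r\<rfloor>))"

definition real_analytic :: "(real \<Rightarrow> real) \<Rightarrow> bool" where
  "real_analytic f \<longleftrightarrow> (\<forall>x. \<exists>S. (\<lambda>t. f (x + t)) has_fps_expansion S)"

text \<open>
  The continuity of \<open>q\<close> matters only at \<open>z\<close>; without it every isolated zero of a
  nonnegative function would qualify, with any exponent \<open>m\<close>.
\<close>

definition even_order_zero :: "(real \<Rightarrow> real) \<Rightarrow> real \<Rightarrow> bool" where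
  "even_order_zero f z \<longleftrightarrow>
     (\<exists>\<epsilon> m q. \<epsilon> > 0 \<and> even m \<and> m > (0::nat) \<and>
        continuous_on {z - \<epsilon> <..< z + \<epsilon>} q \<and>
        (\<forall>\<theta> \<in> {z - \<epsilon> <..< z + \<epsilon>}. f \<theta> = (\<theta> - z) ^ m * q \<theta> \<and> q \<theta> > 0))"

definition lip_const_on :: "real set \<Rightarrow> (real \<Rightarrow> real) \<Rightarrow> ennreal" where
  "lip_const_on I f =
     (SUP (x, y) \<in> {(x, y). x \<in> I \<and> y \<in> I \<and> x \<noteq> y}. ennreal (\<bar>f x - f y\<bar> / \<bar>x - y\<bar>))"


section \<open>The four skew products\<close>

definition h1 :: "real \<Rightarrow> real \<Rightarrow> real" where
  "h1 a x = (if x < - (pi / (2 * a)) then - (pi / 2)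
             else if \<bar>x\<bar> \<le> pi / (2 * a) then a * x
             else pi / 2)"

definition h2 :: "real \<Rightarrow> real \<Rightarrow> real \<Rightarrow> real" where
  "h2 \<delta> a x = (if x < - \<delta> then a * (x + \<delta>)
               else if \<bar>x\<bar> \<le> \<delta> then 0
               else a * (x - \<delta>))"

definition h3 :: "real \<Rightarrow> real \<Rightarrow> real" where
  "h3 a x = (if x > - (1 / a) then a * x else - 1)"

definition h4 :: "real \<Rightarrow> real \<Rightarrow> real" where
  "h4 a x = (if x > 1 / a then a * x else 1)"

text \<open>
  Throughout, the index \<open>i\<close> is meant to range over \<open>{1, 2, 3, 4}\<close>; the final \<open>else\<close> branches
  below are the case \<open>i = 4\<close>. The parameter \<open>\<delta>\<close> is only relevant for \<open>i = 2\<close>.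
\<close>

definition h :: "nat \<Rightarrow> real \<Rightarrow> real \<Rightarrow> real \<Rightarrow> real" where
  "h i \<delta> a = (if i = 1 then h1 a else if i = 2 then h2 \<delta> a else if i = 3 then h3 a else h4 a)"

definition sgn_idx :: "nat \<Rightarrow> real" where
  "sgn_idx i = (if i = 1 \<or> i = 4 then - 1 else 1)"

definition skew_map ::
  "nat \<Rightarrow> real \<Rightarrow> real \<Rightarrow> real \<Rightarrow> (real \<Rightarrow> real) \<Rightarrow> real \<Rightarrow> real \<times> real \<Rightarrow> real \<times> real" where
  "skew_map i \<delta> a \<omega> g b = (\<lambda>(x, \<theta>). (h i \<delta> a x + sgn_idx i * b * g \<theta>, \<theta> + \<omega>))"

definition graph_transform ::
  "nat \<Rightarrow> real \<Rightarrow> real \<Rightarrow> real \<Rightarrow> (real \<Rightarrow> real) \<Rightarrow> real \<Rightarrow> (real \<Rightarrow> real) \<Rightarrow> real \<Rightarrow> real" where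
  "graph_transform i \<delta> a \<omega> g b \<phi> \<theta> = fst (skew_map i \<delta> a \<omega> g b (\<phi> (\<theta> - \<omega>), \<theta> - \<omega>))"


section \<open>Curves\<close>

text \<open>
  The continuous curve on the circle with \<open>m (\<theta> + \<omega>) = E (m \<theta>) \<theta>\<close>. For the affine right-hand
  sides below, of slope \<open>a\<close> with \<open>\<bar>a\<bar> > 1\<close>, it exists and is unique (invert and contract).
\<close>

definition invariant_curve :: "real \<Rightarrow> (real \<Rightarrow> real \<Rightarrow> real) \<Rightarrow> real \<Rightarrow> real" where
  "invariant_curve \<omega> E =
     (THE m. circle_fun m \<and> continuous_on UNIV m \<and> (\<forall>\<theta>. m (\<theta> + \<omega>) = E (m \<theta>) \<theta>))"

definition mu :: "nat \<Rightarrow> real \<Rightarrow> real \<Rightarrow> real \<Rightarrow> (real \<Rightarrow> real) \<Rightarrow> real \<Rightarrow> real \<Rightarrow> real" where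
  "mu i \<delta> a \<omega> g b =
     (if i = 1 then invariant_curve \<omega> (\<lambda>x \<theta>. a * x - b * g \<theta>)
      else if i = 2 then invariant_curve \<omega> (\<lambda>x \<theta>. a * (x - \<delta>) + b * g \<theta>)
      else if i = 3 then invariant_curve \<omega> (\<lambda>x \<theta>. a * x + b * g \<theta>)
      else invariant_curve \<omega> (\<lambda>x \<theta>. a * x - b * g \<theta>))"

definition mu2_hat :: "real \<Rightarrow> real \<Rightarrow> real \<Rightarrow> (real \<Rightarrow> real) \<Rightarrow> real \<Rightarrow> real \<Rightarrow> real" where
  "mu2_hat \<delta> a \<omega> g b = invariant_curve \<omega> (\<lambda>x \<theta>. a * (x + \<delta>) + b * g \<theta>)"

definition gamma1_tilde :: "real \<Rightarrow> (real \<Rightarrow> real) \<Rightarrow> real \<Rightarrow> real \<Rightarrow> real" where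
  "gamma1_tilde \<omega> g b \<theta> = - (pi / 2) - b * g (\<theta> - \<omega>)"

definition phi0 :: "nat \<Rightarrow> real \<Rightarrow> (real \<Rightarrow> real) \<Rightarrow> real \<Rightarrow> real \<Rightarrow> real" where
  "phi0 i \<omega> g b \<theta> =
     (if i = 1 then pi / 2 - b * g (\<theta> - \<omega>)
      else if i = 2 then b * g (\<theta> - \<omega>)
      else if i = 3 then - 1 + b * g (\<theta> - \<omega>)
      else 1 - b * g (\<theta> - \<omega>))"

definition curve_step ::
  "nat \<Rightarrow> real \<Rightarrow> real \<Rightarrow> real \<Rightarrow> (real \<Rightarrow> real) \<Rightarrow> real \<Rightarrow> (real \<Rightarrow> real) \<Rightarrow> real \<Rightarrow> real" where
  "curve_step i \<delta> a \<omega> g b =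
     (if i = 4 then graph_transform i \<delta> a \<omega> g b \<circ> graph_transform i \<delta> a \<omega> g b
      else graph_transform i \<delta> a \<omega> g b)"

definition phi :: "nat \<Rightarrow> real \<Rightarrow> real \<Rightarrow> real \<Rightarrow> (real \<Rightarrow> real) \<Rightarrow> real \<Rightarrow> nat \<Rightarrow> real \<Rightarrow> real" where
  "phi i \<delta> a \<omega> g b n = (curve_step i \<delta> a \<omega> g b ^^ n) (phi0 i \<omega> g b)"

definition phi_inf :: "nat \<Rightarrow> real \<Rightarrow> real \<Rightarrow> real \<Rightarrow> (real \<Rightarrow> real) \<Rightarrow> real \<Rightarrow> real \<Rightarrow> real" where
  "phi_inf i \<delta> a \<omega> g b \<theta> = lim (\<lambda>n. phi i \<delta> a \<omega> g b n \<theta>)"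

definition lambda0 :: "nat \<Rightarrow> real \<Rightarrow> real \<Rightarrow> real \<Rightarrow> (real \<Rightarrow> real) \<Rightarrow> real \<Rightarrow> real \<Rightarrow> real" where
  "lambda0 i \<delta> a \<omega> g b \<theta> =
     (if i = 1 \<or> i = 4 then phi0 i \<omega> g b \<theta> - mu i \<delta> a \<omega> g b \<theta>
      else mu i \<delta> a \<omega> g b \<theta> - phi0 i \<omega> g b \<theta>)"


section \<open>Bifurcation value\<close>

definition graphs_meet :: "(real \<Rightarrow> real) \<Rightarrow> (real \<Rightarrow> real) \<Rightarrow> bool" where
  "graphs_meet f k \<longleftrightarrow> (\<exists>\<theta>. f \<theta> = k \<theta>)"

definition curves_collide :: "nat \<Rightarrow> real \<Rightarrow> real \<Rightarrow> real \<Rightarrow> (real \<Rightarrow> real) \<Rightarrow> real \<Rightarrow> bool" where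
  "curves_collide i \<delta> a \<omega> g b \<longleftrightarrow>
     graphs_meet (phi0 i \<omega> g b) (mu i \<delta> a \<omega> g b) \<or>
     (i = 1 \<and> graphs_meet (gamma1_tilde \<omega> g b) (mu i \<delta> a \<omega> g b)) \<or>
     (i = 2 \<and> graphs_meet (phi0 i \<omega> g b) (mu2_hat \<delta> a \<omega> g b))"

definition is_bifurcation_value ::
  "nat \<Rightarrow> real \<Rightarrow> real \<Rightarrow> real \<Rightarrow> (real \<Rightarrow> real) \<Rightarrow> real \<Rightarrow> bool" where
  "is_bifurcation_value i \<delta> a \<omega> g bs \<longleftrightarrow>
     bs > 0 \<and> curves_collide i \<delta> a \<omega> g bs \<and>
     (\<forall>b. b > 0 \<and> curves_collide i \<delta> a \<omega> g b \<longrightarrow> bs \<le> b)"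

end

theory Submission
  imports Defs "HOL-Complex_Analysis.Conformal_Mappings"
begin

text \<open>
  All the curves \<open>\<mu>\<^sub>i\<close> are, up to sign and a constant, multiples of
  \<open>m \<theta> = (\<Sum>k. g (\<theta> + k \<omega>) / a ^ (k + 1))\<close>, so they are Lipschitz locally uniformly in \<open>b\<close>,
  and \<open>\<lambda>\<^sub>0 = c - b * a * m (\<theta> - \<omega>)\<close> with a constant \<open>c > 0\<close>. In the coordinate
  \<open>\<lambda>\<^sub>n = \<plusminus>(\<phi>\<^sub>n - \<mu>\<^sub>i)\<close> the dynamics reads \<open>\<lambda>\<^sub>n\<^sub>+\<^sub>1 \<theta> = min (A * \<lambda>\<^sub>n (\<theta> - \<Omega>)) (\<lambda>\<^sub>0 \<theta>)\<close>, with
  \<open>(A, \<Omega>) = (a, \<omega>)\<close>, or \<open>(a\<^sup>2, 2\<omega>)\<close> for \<open>i = 4\<close>, hence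
  \<open>\<phi>\<^sub>\<infinity> = \<mu>\<^sub>i \<plusminus> (INF k. A ^ k * \<lambda>\<^sub>0 (\<theta> - k \<Omega>))\<close>.

  As \<open>b\<close> tends to \<open>b\<^sup>*\<close>, the infimum tends to 0 along the forward orbit of a zero of \<open>\<lambda>\<^sub>0\<close>, which is
  dense. On the other hand the zeros of \<open>\<lambda>\<^sub>0\<close> at \<open>b\<^sup>*\<close> have finite order, so for almost every \<open>\<theta>\<close> the
  infimum is bounded away from 0 uniformly for \<open>b\<close> near \<open>b\<^sup>*\<close>. Two such points can be chosen
  arbitrarily close to each other in any interval.
\<close>

section \<open>Functions on the circle\<close>

lemma circle_fun_shift_int:
  assumes "circle_fun f"
  shows "f (x + 2 * pi * of_int n) = f x"
proof -
  have nat: "f (y + 2 * pi * real k) = f y" for y k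
  proof (induction k)
    case (Suc k)
    have "f (y + 2 * pi * real (Suc k)) = f (y + 2 * pi * real k + 2 * pi)"
      by (simp add: algebra_simps)
    then show ?case
      using assms Suc by (simp add: circle_fun_def)
  qed simp
  show ?thesis
  proof (cases "n \<ge> 0")
    case True
    then show ?thesis
      using nat[of x "nat n"] by simp
  next
    case False
    then show ?thesis
      using nat[of "x + 2 * pi * of_int n" "nat (- n)"] by simp
  qed
qed

lemma circle_representative:
  obtains n :: int and y where "x = y + 2 * pi * of_int n" "y \<in> {0..2 * pi}"
proof
  let ?n = "\<lfloor>x / (2 * pi)\<rfloor>"
  show "x = (x - 2 * pi * of_int ?n) + 2 * pi * of_int ?n"
    by simp
  have "of_int ?n * (2 * pi) \<le> x / (2 * pi) * (2 * pi)"
      "x / (2 * pi) * (2 * pi) \<le> (of_int ?n + 1) * (2 * pi)"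
    by (intro mult_right_mono; linarith?; simp)+
  then show "x - 2 * pi * of_int ?n \<in> {0..2 * pi}"
    by (simp add: algebra_simps)
qed

lemma circle_fun_bounded:
  fixes f :: "real \<Rightarrow> real"
  assumes "circle_fun f" "continuous_on UNIV f"
  obtains B where "B \<ge> 0" "\<And>x. \<bar>f x\<bar> \<le> B"
proof -
  have "bounded (f ` {0..2 * pi})"
    by (intro compact_imp_bounded compact_continuous_image continuous_on_subset[OF assms(2)]) auto
  then obtain B where B: "\<And>x. x \<in> {0..2 * pi} \<Longrightarrow> \<bar>f x\<bar> \<le> B"
    unfolding bounded_iff by (metis imageI real_norm_def)
  have "\<bar>f x\<bar> \<le> B" for x
    by (rule circle_representative[of x]) (use B circle_fun_shift_int[OF assms(1)] in auto)
  moreover have "B \<ge> 0"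
    using B[of 0] by simp
  ultimately show ?thesis
    by (rule that[rotated])
qed

text \<open>Kronecker's theorem, after division by \<open>2 * pi\<close>; the integer
  \<open>j\<close> absorbs the two integer parts.\<close>

lemma circle_orbit_dense:
  assumes "\<Omega> / (2 * pi) \<notin> \<rat>" "d > 0"
  obtains k :: nat and j :: int where "\<bar>z + real k * \<Omega> + 2 * pi * of_int j - t\<bar> < d"
proof -
  let ?\<alpha> = "frac ((t - z) / (2 * pi))"
  have "0 \<le> ?\<alpha>" "?\<alpha> \<le> 1"
    using frac_lt_1[of "(t - z) / (2 * pi)"] by auto
  then obtain k where "k > 0" "\<bar>frac (real k * (\<Omega> / (2 * pi))) - ?\<alpha>\<bar> < d / (2 * pi)"
    using Kronecker_approx_1_explicit[OF assms(1), of ?\<alpha> "d / (2 * pi)"] assms(2)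
    by auto
  then have k: "\<bar>real k * (\<Omega> / (2 * pi)) - of_int \<lfloor>real k * (\<Omega> / (2 * pi))\<rfloor>
      - ((t - z) / (2 * pi) - of_int \<lfloor>(t - z) / (2 * pi)\<rfloor>)\<bar> < d / (2 * pi)"
    by (simp add: frac_def)
  let ?j = "\<lfloor>(t - z) / (2 * pi)\<rfloor> - \<lfloor>real k * (\<Omega> / (2 * pi))\<rfloor>"
  have "\<bar>z + real k * \<Omega> + 2 * pi * of_int ?j - t\<bar> / (2 * pi) = \<bar>(z + real k * \<Omega> + 2 * pi * of_int ?j - t) / (2 * pi)\<bar>"
    by simp
  also have "(z + real k * \<Omega> + 2 * pi * of_int ?j - t) / (2 * pi) =
      real k * (\<Omega> / (2 * pi)) - of_int \<lfloor>real k * (\<Omega> / (2 * pi))\<rfloor>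
      - ((t - z) / (2 * pi) - of_int \<lfloor>(t - z) / (2 * pi)\<rfloor>)"
    by (simp add: field_simps)
  finally have "\<bar>z + real k * \<Omega> + 2 * pi * of_int ?j - t\<bar> / (2 * pi) < d / (2 * pi)"
    using k by simp
  then have "\<bar>z + real k * \<Omega> + 2 * pi * of_int ?j - t\<bar> < d"
    by (simp add: divide_less_cancel)
  then show ?thesis
    by (rule that)
qed

text \<open>\<open>deriv g\<close> is continuous in both cases: for \<tau> < 1 it is the last
  derivative that the class controls, otherwise it is itself differentiable. Being periodic, it is
  then bounded, and the mean value bound applies.\<close>

lemma holder_class_circle_lipschitz:
  assumes "circle_fun g" "holder_class (1 + \<tau>) g" "\<tau> > 0"
  obtains K where "K \<ge> 0" "\<And>x y. \<bar>g x - g y\<bar> \<le> K * \<bar>x - y\<bar>"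
proof -
  have n: "nat \<lfloor>1 + \<tau>\<rfloor> \<ge> 1"
    using assms(3) by linarith
  have diff: "(deriv ^^ k) g differentiable (at x)" if "k < nat \<lfloor>1 + \<tau>\<rfloor>" for k x
    using assms(2) that unfolding holder_class_def by blast
  have d: "(g has_real_derivative deriv g x) (at x)" for x
    using diff[of 0 x] n by (simp add: DERIV_deriv_iff_real_differentiable)
  have "continuous_on UNIV (deriv g)"
  proof (cases "nat \<lfloor>1 + \<tau>\<rfloor> = 1")
    case True
    then show ?thesis
      using assms(2) unfolding holder_class_def by simp
  next
    case False
    then have "1 < nat \<lfloor>1 + \<tau>\<rfloor>"
      using n by linarith
    then have "deriv g differentiable (at x)" for x
      using diff[of 1 x] by simp
    then show ?thesis
      by (auto intro!: continuous_at_imp_continuous_on differentiable_imp_continuous_within)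
  qed
  moreover have "circle_fun (deriv g)"
    unfolding circle_fun_def
  proof
    fix x
    have "((\<lambda>y. g (y + 2 * pi)) has_real_derivative deriv g (x + 2 * pi)) (at x)"
      using d[of "x + 2 * pi"] by (simp add: DERIV_shift add.commute)
    moreover have "(\<lambda>y. g (y + 2 * pi)) = g"
      using assms(1) by (auto simp: circle_fun_def)
    ultimately show "deriv g (x + 2 * pi) = deriv g x"
      using d DERIV_unique by metis
  qed
  ultimately obtain B where B: "B \<ge> 0" "\<And>x. \<bar>deriv g x\<bar> \<le> B"
    using circle_fun_bounded by blast
  have "norm (g x - g y) \<le> B * norm (x - y)" for x y
    by (rule field_differentiable_bound[of UNIV g "deriv g" B x y])
      (use d B in auto)
  then show ?thesis
    using B(1) by (intro that[of B]) (auto simp: abs_minus_commute)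
qed

lemma continuous_on_lipschitz_bound:
  fixes g :: "real \<Rightarrow> real"
  assumes "\<And>x y. \<bar>g x - g y\<bar> \<le> K * \<bar>x - y\<bar>" "K \<ge> 0"
  shows "continuous_on UNIV g"
  using assms by (intro lipschitz_on_continuous_on[of K]) (auto simp: lipschitz_on_def dist_real_def)

section \<open>The invariant curves\<close>

text \<open>For \<open>\<bar>a\<bar> > 1\<close>, the bounded solution of
  \<open>m (\<theta> + \<omega>) = a * m \<theta> - g \<theta>\<close>, obtained by solving for
  \<open>m \<theta>\<close> and iterating forwards.\<close>

definition twisted_sum :: "real \<Rightarrow> real \<Rightarrow> (real \<Rightarrow> real) \<Rightarrow> real \<Rightarrow> real" where
  "twisted_sum a \<omega> g \<theta> = (\<Sum>k. g (\<theta> + real k * \<omega>) / a ^ Suc k)"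

context
  fixes a \<omega> :: real and g :: "real \<Rightarrow> real"
  assumes a: "\<bar>a\<bar> > 1" and per: "circle_fun g" and cont: "continuous_on UNIV g"
begin

lemma summable_geometric_abs: "summable (\<lambda>k. B / \<bar>a\<bar> ^ Suc k)"
proof -
  have "summable (\<lambda>k. (1 / \<bar>a\<bar>) ^ k * (B / \<bar>a\<bar>))"
    using a by (intro summable_mult2 summable_geometric) auto
  then show ?thesis
    by (simp add: power_divide mult.commute)
qed

lemma twisted_sum_summable: "summable (\<lambda>k. g (\<theta> + real k * \<omega>) / a ^ Suc k)"
proof -
  obtain B where "\<And>x. \<bar>g x\<bar> \<le> B"
    using circle_fun_bounded[OF per cont] by blast
  then show ?thesis
    by (intro summable_comparison_test'[OF summable_geometric_abs[of B]])
      (auto simp: abs_mult power_abs intro!: divide_right_mono)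
qed

lemma twisted_sum_shift: "twisted_sum a \<omega> g (\<theta> + \<omega>) = a * twisted_sum a \<omega> g \<theta> - g \<theta>"
proof -
  let ?f = "\<lambda>k. g (\<theta> + real k * \<omega>) / a ^ Suc k"
  have "(\<Sum>k. ?f (Suc k)) = twisted_sum a \<omega> g \<theta> - ?f 0"
    unfolding twisted_sum_def by (rule suminf_split_head[OF twisted_sum_summable])
  moreover have "twisted_sum a \<omega> g (\<theta> + \<omega>) = (\<Sum>k. a * ?f (Suc k))"
    unfolding twisted_sum_def using a by (intro suminf_cong) (auto simp: field_simps)
  moreover have "(\<Sum>k. a * ?f (Suc k)) = a * (\<Sum>k. ?f (Suc k))"
    by (intro suminf_mult) (use summable_Suc_iff[of ?f] twisted_sum_summable in blast)
  moreover have "a * ?f 0 = g \<theta>"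
    using a by auto
  ultimately show ?thesis
    by (simp only: right_diff_distrib)
qed

lemma circle_fun_twisted_sum: "circle_fun (twisted_sum a \<omega> g)"
proof -
  have "g (\<theta> + 2 * pi + real k * \<omega>) = g (\<theta> + real k * \<omega>)" for \<theta> k
    using circle_fun_shift_int[OF per, of "\<theta> + real k * \<omega>" 1] by (simp add: algebra_simps)
  then show ?thesis
    by (simp add: circle_fun_def twisted_sum_def)
qed

lemma twisted_sum_lipschitz:
  assumes "\<And>x y. \<bar>g x - g y\<bar> \<le> K * \<bar>x - y\<bar>"
  shows "\<bar>twisted_sum a \<omega> g x - twisted_sum a \<omega> g y\<bar> \<le> (\<Sum>k. K / \<bar>a\<bar> ^ Suc k) * \<bar>x - y\<bar>"
proof -
  let ?f = "\<lambda>k. g (x + real k * \<omega>) / a ^ Suc k - g (y + real k * \<omega>) / a ^ Suc k"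
  have le: "\<bar>?f k\<bar> \<le> K / \<bar>a\<bar> ^ Suc k * \<bar>x - y\<bar>" for k
    using assms[of "x + real k * \<omega>" "y + real k * \<omega>"] a
    by (simp add: diff_divide_distrib[symmetric] abs_mult power_abs divide_right_mono)
  have s: "summable (\<lambda>k. K / \<bar>a\<bar> ^ Suc k * \<bar>x - y\<bar>)"
    by (intro summable_mult2 summable_geometric_abs)
  have "twisted_sum a \<omega> g x - twisted_sum a \<omega> g y = suminf ?f"
    unfolding twisted_sum_def by (rule suminf_diff[OF twisted_sum_summable twisted_sum_summable])
  also have "\<bar>\<dots>\<bar> \<le> (\<Sum>k. \<bar>?f k\<bar>)"
    by (intro summable_rabs summable_comparison_test'[OF s]) (use le in auto)
  also have "\<dots> \<le> (\<Sum>k. K / \<bar>a\<bar> ^ Suc k * \<bar>x - y\<bar>)"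
    using le by (intro suminf_le s summable_comparison_test'[OF s]) auto
  also have "\<dots> = (\<Sum>k. K / \<bar>a\<bar> ^ Suc k) * \<bar>x - y\<bar>"
    by (rule suminf_mult2[OF summable_geometric_abs, symmetric])
  finally show ?thesis .
qed

lemma continuous_on_twisted_sum: "continuous_on UNIV (twisted_sum a \<omega> g)"
proof -
  obtain B where B: "\<And>x. \<bar>g x\<bar> \<le> B"
    using circle_fun_bounded[OF per cont] by blast
  have "uniform_limit UNIV (\<lambda>n \<theta>. \<Sum>k<n. g (\<theta> + real k * \<omega>) / a ^ Suc k)
      (\<lambda>\<theta>. \<Sum>k. g (\<theta> + real k * \<omega>) / a ^ Suc k) sequentially"
    by (rule Weierstrass_m_test[OF _ summable_geometric_abs[of B]])
      (use B in \<open>auto simp: abs_mult power_abs intro!: divide_right_mono\<close>)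
  moreover have "continuous_on UNIV (\<lambda>\<theta>. \<Sum>k<n. g (\<theta> + real k * \<omega>) / a ^ Suc k)" for n
    using a by (intro continuous_intros continuous_on_compose2[OF cont]) auto
  ultimately have "continuous_on UNIV (\<lambda>\<theta>. \<Sum>k. g (\<theta> + real k * \<omega>) / a ^ Suc k)"
    by (intro uniform_limit_theorem[rotated]) auto
  then show ?thesis
    by (simp add: twisted_sum_def[abs_def])
qed

lemma twisted_sum_nonneg:
  assumes "a > 0" "\<And>\<theta>. g \<theta> \<ge> 0"
  shows "twisted_sum a \<omega> g \<theta> \<ge> 0"
  unfolding twisted_sum_def using assms by (intro suminf_nonneg twisted_sum_summable) auto

text \<open>The constant \<open>e\<close> is balanced by the fixed point \<kappa> of
  \<open>x \<mapsto> a * x + e\<close>, the forcing by a multiple of \<open>twisted_sum\<close>. The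
  difference of two solutions is multiplied by \<open>a\<close> at each step of the rotation, so it
  is bounded only if it vanishes; this uniqueness evaluates the \<open>THE\<close>.\<close>

lemma invariant_curve_affine:
  assumes E: "\<And>x \<theta>. E x \<theta> = a * x + e + d * g \<theta>"
  shows "invariant_curve \<omega> E = (\<lambda>\<theta>. - e / (a - 1) - d * twisted_sum a \<omega> g \<theta>)"
proof -
  define \<kappa> where "\<kappa> = - e / (a - 1)"
  define m0 where "m0 = (\<lambda>\<theta>. \<kappa> - d * twisted_sum a \<omega> g \<theta>)"
  define P where "P m \<longleftrightarrow> circle_fun m \<and> continuous_on UNIV m \<and> (\<forall>\<theta>. m (\<theta> + \<omega>) = E (m \<theta>) \<theta>)" for m
  have "\<kappa> = a * \<kappa> + e"
    using a by (simp add: \<kappa>_def divide_simps) (simp add: algebra_simps)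
  then have "m0 (\<theta> + \<omega>) = E (m0 \<theta>) \<theta>" for \<theta>
    unfolding E m0_def twisted_sum_shift by (simp add: algebra_simps)
  then have P0: "P m0"
    using circle_fun_twisted_sum continuous_on_twisted_sum
    by (auto simp: P_def m0_def circle_fun_def intro!: continuous_intros)
  have "m = m0" if "P m" for m
  proof -
    let ?D = "\<lambda>\<theta>. m \<theta> - m0 \<theta>"
    have "circle_fun ?D" "continuous_on UNIV ?D"
      using \<open>P m\<close> P0 by (auto simp: P_def circle_fun_def intro!: continuous_intros)
    then obtain B where B: "\<And>\<theta>. \<bar>?D \<theta>\<bar> \<le> B"
      using circle_fun_bounded by blast
    have step: "?D (\<theta> + \<omega>) = a * ?D \<theta>" for \<theta>
      using \<open>P m\<close> P0 by (simp add: P_def E right_diff_distrib)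
    have iter: "?D (\<theta> + real k * \<omega>) = a ^ k * ?D \<theta>" for \<theta> k
    proof (induction k)
      case (Suc k)
      have "?D (\<theta> + real (Suc k) * \<omega>) = ?D (\<theta> + real k * \<omega> + \<omega>)"
        by (simp add: algebra_simps)
      also have "\<dots> = a * ?D (\<theta> + real k * \<omega>)"
        by (rule step)
      also have "\<dots> = a ^ Suc k * ?D \<theta>"
        by (simp only: Suc power_Suc mult.assoc)
      finally show ?case .
    qed simp
    have "?D \<theta> = 0" for \<theta>
    proof (rule ccontr)
      assume "?D \<theta> \<noteq> 0"
      then obtain k where "\<bar>a\<bar> ^ k > B / \<bar>?D \<theta>\<bar>"
        using real_arch_pow[OF a] by blast
      then have "\<bar>a ^ k * ?D \<theta>\<bar> > B"
        using \<open>?D \<theta> \<noteq> 0\<close> unfolding abs_mult power_abs by (simp add: divide_less_eq)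
      then show False
        using B[of "\<theta> + real k * \<omega>"] iter[of \<theta> k] by linarith
    qed
    then show "m = m0"
      by auto
  qed
  then have "(THE m. P m) = m0"
    using P0 by (intro the_equality)
  then show ?thesis
    by (simp add: invariant_curve_def P_def m0_def \<kappa>_def)
qed

end

section \<open>The attracting curves\<close>

text \<open>The \<open>k\<close>-th term is the cap \<open>f\<close> met \<open>k\<close> steps ago
  and carried to the present with expansion \<open>A\<close> per step.\<close>

definition orbit_inf :: "real \<Rightarrow> real \<Rightarrow> (real \<Rightarrow> real) \<Rightarrow> real \<Rightarrow> real" where
  "orbit_inf A \<Omega> f \<theta> = (INF k. A ^ k * f (\<theta> - real k * \<Omega>))"

lemma orbit_inf_le:
  assumes "A > 0" "\<And>\<theta>. f \<theta> \<ge> 0"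
  shows "orbit_inf A \<Omega> f \<theta> \<le> A ^ k * f (\<theta> - real k * \<Omega>)"
  unfolding orbit_inf_def using assms
  by (intro cINF_lower bdd_belowI[of _ 0]) auto

lemma orbit_inf_ge:
  assumes "\<And>k. s \<le> A ^ k * f (\<theta> - real k * \<Omega>)"
  shows "s \<le> orbit_inf A \<Omega> f \<theta>"
  unfolding orbit_inf_def using assms by (intro cINF_greatest) auto

text \<open>Unrolling the recursion, \<open>u n \<theta>\<close> is the minimum of the terms of
  \<open>orbit_inf\<close> with index at most \<open>n\<close>. The bounds \<open>lower\<close> and
  \<open>upper\<close> express this without a finite minimum.\<close>

lemma capped_iteration_tendsto:
  assumes A: "A > 0" and f: "\<And>\<theta>. f \<theta> \<ge> 0"
    and u0: "\<And>\<theta>. u 0 \<theta> = f \<theta>"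
    and uS: "\<And>n \<theta>. u (Suc n) \<theta> = min (A * u n (\<theta> - \<Omega>)) (f \<theta>)"
  shows "(\<lambda>n. u n \<theta>) \<longlonglongrightarrow> orbit_inf A \<Omega> f \<theta>"
proof -
  have lower: "s \<le> u n \<theta>" if "\<And>k. s \<le> A ^ k * f (\<theta> - real k * \<Omega>)" for s n \<theta>
    using that
  proof (induction n arbitrary: s \<theta>)
    case 0
    then show ?case
      using 0[of 0] by (simp add: u0)
  next
    case (Suc n)
    \<comment> \<open>Division by \<open>A\<close> turns the terms of index at least 1 at \<theta>
      into all the terms at \<theta> - \<Omega>.\<close>
    have "s / A \<le> A ^ k * f (\<theta> - \<Omega> - real k * \<Omega>)" for k
      using Suc.prems[of "Suc k"] A by (simp add: field_simps)
    then have "s / A \<le> u n (\<theta> - \<Omega>)"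
      by (rule Suc.IH)
    then show ?case
      using Suc.prems[of 0] A by (simp add: uS field_simps)
  qed
  have upper: "u n \<theta> \<le> A ^ k * f (\<theta> - real k * \<Omega>)" if "k \<le> n" for k n \<theta>
    using that
  proof (induction k arbitrary: n \<theta>)
    case 0
    then show ?case
      by (cases n) (auto simp: u0 uS)
  next
    case (Suc k)
    then obtain n' where n: "n = Suc n'" "k \<le> n'"
      by (cases n) auto
    have "u n' (\<theta> - \<Omega>) \<le> A ^ k * f (\<theta> - \<Omega> - real k * \<Omega>)"
      using Suc.IH n by blast
    then have "A * u n' (\<theta> - \<Omega>) \<le> A * (A ^ k * f (\<theta> - \<Omega> - real k * \<Omega>))"
      using A by (intro mult_left_mono) auto
    then show ?case
      by (simp add: n uS min_le_iff_disj algebra_simps)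
  qed
  show ?thesis
  proof (rule order_tendstoI)
    fix s assume "s < orbit_inf A \<Omega> f \<theta>"
    also have "orbit_inf A \<Omega> f \<theta> \<le> u n \<theta>" for n
      by (rule lower) (rule orbit_inf_le[OF A f])
    finally show "\<forall>\<^sub>F n in sequentially. s < u n \<theta>"
      by simp
  next
    fix s assume "orbit_inf A \<Omega> f \<theta> < s"
    then obtain k where "A ^ k * f (\<theta> - real k * \<Omega>) < s"
      using orbit_inf_ge[of s A f \<theta> \<Omega>] by (meson not_less)
    then have "u n \<theta> < s" if "n \<ge> k" for n
      using upper[OF that, of \<theta>] by linarith
    then show "\<forall>\<^sub>F n in sequentially. u n \<theta> < s"
      unfolding eventually_sequentially by blast
  qed
qed

text \<open>The value of \<open>mu\<close> at \<open>b = 0\<close>: the fixed point of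
  \<open>x \<mapsto> a * (x - \<delta>)\<close> for \<open>i = 2\<close>, of
  \<open>x \<mapsto> a * x\<close> otherwise.\<close>

definition curve_offset :: "nat \<Rightarrow> real \<Rightarrow> real \<Rightarrow> real" where
  "curve_offset i \<delta> a = (if i = 2 then a * \<delta> / (a - 1) else 0)"

text \<open>The constant value of \<open>lambda0\<close> at \<open>b = 0\<close>.\<close>

definition curve_gap :: "nat \<Rightarrow> real \<Rightarrow> real \<Rightarrow> real" where
  "curve_gap i \<delta> a = (if i = 1 then pi / 2 else if i = 2 then a * \<delta> / (a - 1) else 1)"

section \<open>The dynamics in coordinates relative to \<open>mu\<close>\<close>

context
  fixes i :: nat and a \<delta> \<omega> :: real and g :: "real \<Rightarrow> real"
  assumes i: "i \<in> {1, 2, 3, 4}"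
    and a_pos: "i \<in> {1, 2, 3} \<Longrightarrow> a > 1" and a_neg: "i = 4 \<Longrightarrow> a < - 1"
    and \<delta>: "\<delta> > 0" and per: "circle_fun g" and cont: "continuous_on UNIV g"
    and g: "\<And>\<theta>. g \<theta> \<ge> 0"
begin

lemma abs_slope_gt_1: "\<bar>a\<bar> > 1"
  using i a_pos a_neg by fastforce

lemma curve_gap_pos: "curve_gap i \<delta> a > 0"
  using i a_pos \<delta> by (auto simp: curve_gap_def)

lemma mu_eq: "mu i \<delta> a \<omega> g b = (\<lambda>\<theta>. curve_offset i \<delta> a - sgn_idx i * b * twisted_sum a \<omega> g \<theta>)"
proof -
  note ic = invariant_curve_affine[OF abs_slope_gt_1 per cont]
  show ?thesis
    using ic[of "\<lambda>x \<theta>. a * x - b * g \<theta>" 0 "- b"] ic[of "\<lambda>x \<theta>. a * x + b * g \<theta>" 0 b]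
      ic[of "\<lambda>x \<theta>. a * (x - \<delta>) + b * g \<theta>" "- a * \<delta>" b] i
    by (auto simp: mu_def curve_offset_def sgn_idx_def algebra_simps)
qed

lemma mu2_hat_eq:
  "mu2_hat \<delta> a \<omega> g b = (\<lambda>\<theta>. - (a * \<delta> / (a - 1)) - b * twisted_sum a \<omega> g \<theta>)"
  unfolding mu2_hat_def
  using invariant_curve_affine[OF abs_slope_gt_1 per cont, of "\<lambda>x \<theta>. a * (x + \<delta>) + b * g \<theta>" "a * \<delta>" b]
  by (simp add: algebra_simps)

lemma twisted_sum_unshift: "twisted_sum a \<omega> g \<theta> + g (\<theta> - \<omega>) = a * twisted_sum a \<omega> g (\<theta> - \<omega>)"
  using twisted_sum_shift[OF abs_slope_gt_1 per cont, of \<omega> "\<theta> - \<omega>"] by simp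

text \<open>The functional equation merges the forcing term of \<open>phi0\<close> with that of
  \<open>mu\<close>. Thus \<open>lambda0\<close> is affine in \<open>b\<close>, with a profile in
  \<theta> that is the same for all \<open>b\<close>.\<close>

lemma lambda0_eq:
  "lambda0 i \<delta> a \<omega> g b = (\<lambda>\<theta>. curve_gap i \<delta> a - b * (a * twisted_sum a \<omega> g (\<theta> - \<omega>)))"
  unfolding twisted_sum_unshift[symmetric] lambda0_def mu_eq using i
  by (auto simp: fun_eq_iff phi0_def curve_gap_def curve_offset_def sgn_idx_def algebra_simps)

lemma phi0_eq: "phi0 i \<omega> g b \<theta> = mu i \<delta> a \<omega> g b \<theta> - sgn_idx i * lambda0 i \<delta> a \<omega> g b \<theta>"
  using i by (auto simp: lambda0_def sgn_idx_def)

text \<open>The bounds on \<open>l\<close> put the curve where \<open>h1\<close> and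
  \<open>h2\<close> consist of one branch of slope \<open>a\<close> and one constant piece. The
  slope branch preserves \<open>mu\<close> and multiplies \<open>l\<close> by \<open>a\<close>; the
  constant piece is mapped onto \<open>phi0\<close>, which is the cap \<open>lambda0\<close>. For
  \<open>i = 4\<close> no sign is imposed on \<open>l\<close>, since the formula is also applied to
  the nonpositive \<open>a * l\<close> halfway through a double step.\<close>

lemma graph_transform_eq:
  assumes b: "b \<ge> 0"
    and l: "i \<noteq> 4 \<Longrightarrow> 0 \<le> l (\<theta> - \<omega>) \<and> l (\<theta> - \<omega>) \<le> lambda0 i \<delta> a \<omega> g b (\<theta> - \<omega>)"
  shows "graph_transform i \<delta> a \<omega> g b (\<lambda>\<theta>. mu i \<delta> a \<omega> g b \<theta> - sgn_idx i * l \<theta>) \<theta> =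
    mu i \<delta> a \<omega> g b \<theta> - sgn_idx i * min (a * l (\<theta> - \<omega>)) (lambda0 i \<delta> a \<omega> g b \<theta>)"
proof -
  let ?m = "twisted_sum a \<omega> g (\<theta> - \<omega>)" and ?l = "l (\<theta> - \<omega>)"
  let ?x = "curve_offset i \<delta> a - sgn_idx i * b * ?m - sgn_idx i * ?l"
  have m: "twisted_sum a \<omega> g \<theta> = a * ?m - g (\<theta> - \<omega>)"
    using twisted_sum_unshift[of \<theta>] by simp
  have goal: ?thesis if "h i \<delta> a ?x = curve_offset i \<delta> a
      - sgn_idx i * b * (a * ?m) - sgn_idx i * min (a * ?l) (curve_gap i \<delta> a - b * (a * ?m))"
    using that
    by (simp add: graph_transform_def skew_map_def mu_eq lambda0_eq m algebra_simps)
  have bm: "b * ?m \<ge> 0" if "i \<noteq> 4"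
    using twisted_sum_nonneg[OF abs_slope_gt_1 per cont _ g] a_pos b that i by auto
  consider "i = 1" | "i = 2" | "i = 3" | "i = 4"
    using i by auto
  then show ?thesis
  proof cases
    case 1
    then have a: "a > 1" and l0: "?l \<ge> 0"
      using a_pos l by auto
    have "h1 a x = min (a * x) (pi / 2)" if "x \<ge> 0" for x
    proof -
      have "- (pi / (2 * a)) < 0"
        using a by simp
      then have "h1 a x = (if x \<le> pi / (2 * a) then a * x else pi / 2)"
        using that unfolding h1_def by auto
      then show ?thesis
        using a by (auto simp: min_def field_simps)
    qed
    from this[of ?x] show ?thesis
      using 1 bm l0
      by (intro goal) (simp add: h_def curve_offset_def curve_gap_def sgn_idx_def min_def algebra_simps)
  next
    case 2
    then have a: "a > 1"
      using a_pos by auto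
    \<comment> \<open>The bound \<open>l \<le> lambda0\<close> says that the curve lies above
      \<open>phi0\<close>, whose value at \<theta> - \<omega> is
      \<open>b * g (\<theta> - \<omega> - \<omega>) \<ge> 0\<close>. So the negative branch of
      \<open>h2\<close> is never met.\<close>
    have "b * (twisted_sum a \<omega> g (\<theta> - \<omega>) + g (\<theta> - \<omega> - \<omega>))
        = b * (a * twisted_sum a \<omega> g (\<theta> - \<omega> - \<omega>))"
      by (simp only: twisted_sum_unshift)
    then have "curve_gap i \<delta> a - b * (a * twisted_sum a \<omega> g (\<theta> - \<omega> - \<omega>))
        = curve_offset i \<delta> a - b * ?m - b * g (\<theta> - \<omega> - \<omega>)"
      using 2 by (simp add: curve_gap_def curve_offset_def algebra_simps)
    moreover have "b * g (\<theta> - \<omega> - \<omega>) \<ge> 0"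
      using b g by simp
    ultimately have x: "?x \<ge> 0"
      using l 2 unfolding lambda0_eq by (simp add: sgn_idx_def)
    have h: "h2 \<delta> a x = max (a * x - a * \<delta>) 0" if "x \<ge> 0" for x
    proof -
      have "0 \<le> a * (x - \<delta>) \<longleftrightarrow> \<delta> \<le> x"
        using a by (simp add: zero_le_mult_iff)
      moreover have "h2 \<delta> a x = (if x \<le> \<delta> then 0 else a * (x - \<delta>))"
        using that \<delta> by (auto simp: h2_def)
      ultimately show ?thesis
        by (auto simp: max_def right_diff_distrib[symmetric])
    qed
    define K where "K = a * \<delta> / (a - 1)"
    have K: "curve_offset i \<delta> a = K" "curve_gap i \<delta> a = K"
      using 2 by (simp_all add: curve_offset_def curve_gap_def K_def)
    \<comment> \<open>\<open>K\<close> is the fixed point of the branch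
      \<open>x \<mapsto> a * x - a * \<delta>\<close>.\<close>
    have "a * K - a * \<delta> = K"
      using a by (simp add: K_def divide_simps) (simp add: algebra_simps)
    then have "a * ?x - a * \<delta> = K - b * (a * ?m) - a * ?l"
      unfolding K using 2 by (simp add: sgn_idx_def algebra_simps)
    moreover have "h i \<delta> a ?x = max (a * ?x - a * \<delta>) 0"
      using 2 h[OF x] by (simp add: h_def)
    ultimately show ?thesis
      using 2 by (intro goal, unfold K) (simp add: sgn_idx_def max_def min_def)
  next
    case 3
    then have a: "a > 1"
      using a_pos by auto
    have "h3 a x = max (a * x) (- 1)" for x
      using a by (auto simp: h3_def max_def field_simps)
    from this[of ?x] show ?thesis
      using 3
      by (intro goal) (simp add: h_def curve_offset_def curve_gap_def sgn_idx_def max_def min_def algebra_simps)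
  next
    case 4
    then have a: "a < - 1"
      using a_neg by auto
    have "h4 a x = min (a * x) 1" for x
      using a by (auto simp: h4_def min_def field_simps)
    from this[of ?x] show ?thesis
      using 4
      by (intro goal) (simp add: h_def curve_offset_def curve_gap_def sgn_idx_def min_def algebra_simps)
  qed
qed

text \<open>For \<open>i = 4\<close> the slope is negative, so after the first half of the double
  step \<open>a * l \<le> 0 \<le> lambda0\<close> and the cap does not act. The second half
  multiplies by \<open>a\<close> once more and then caps, hence the factor \<open>a\<^sup>2\<close>
  and the rotation by \<open>2 * \<omega>\<close>.\<close>

lemma curve_step_eq:
  assumes b: "b \<ge> 0" and pos: "\<And>\<theta>. 0 \<le> lambda0 i \<delta> a \<omega> g b \<theta>"
    and l: "\<And>\<theta>. 0 \<le> l \<theta>" "\<And>\<theta>. l \<theta> \<le> lambda0 i \<delta> a \<omega> g b \<theta>"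
  shows "curve_step i \<delta> a \<omega> g b (\<lambda>\<theta>. mu i \<delta> a \<omega> g b \<theta> - sgn_idx i * l \<theta>) =
    (\<lambda>\<theta>. mu i \<delta> a \<omega> g b \<theta> - sgn_idx i *
      min ((if i = 4 then a\<^sup>2 else a) * l (\<theta> - (if i = 4 then 2 * \<omega> else \<omega>))) (lambda0 i \<delta> a \<omega> g b \<theta>))"
proof (cases "i = 4")
  case False
  then show ?thesis
    using l by (auto simp: curve_step_def graph_transform_eq[OF b])
next
  case True
  have neg: "a * l \<theta> \<le> 0" for \<theta>
    using l(1)[of \<theta>] a_neg True by (auto simp: mult_le_0_iff)
  have "min (a * l (\<theta> - \<omega>)) (lambda0 i \<delta> a \<omega> g b \<theta>) = a * l (\<theta> - \<omega>)" for \<theta>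
    using neg[of "\<theta> - \<omega>"] pos[of \<theta>] by linarith
  then have 1: "graph_transform i \<delta> a \<omega> g b (\<lambda>\<theta>. mu i \<delta> a \<omega> g b \<theta> - sgn_idx i * l \<theta>) =
      (\<lambda>\<theta>. mu i \<delta> a \<omega> g b \<theta> - sgn_idx i * (a * l (\<theta> - \<omega>)))"
    by (subst fun_eq_iff, subst graph_transform_eq[OF b]) (use True in auto)
  have "graph_transform i \<delta> a \<omega> g b (\<lambda>\<theta>. mu i \<delta> a \<omega> g b \<theta> - sgn_idx i * (a * l (\<theta> - \<omega>))) =
      (\<lambda>\<theta>. mu i \<delta> a \<omega> g b \<theta> - sgn_idx i * min (a\<^sup>2 * l (\<theta> - 2 * \<omega>)) (lambda0 i \<delta> a \<omega> g b \<theta>))"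
    by (subst fun_eq_iff, subst graph_transform_eq[OF b])
      (use True in \<open>auto simp: power2_eq_square mult.assoc\<close>)
  then show ?thesis
    using True 1 by (simp add: curve_step_def)
qed

text \<open>Relative to \<open>mu\<close> the iteration becomes the capped one. Its iterates stay
  between 0 and \<open>lambda0\<close>, which keeps \<open>curve_step_eq\<close> applicable at every
  step.\<close>

lemma phi_inf_eq:
  assumes b: "b \<ge> 0" and pos: "\<And>\<theta>. 0 \<le> lambda0 i \<delta> a \<omega> g b \<theta>"
  shows "phi_inf i \<delta> a \<omega> g b \<theta> = mu i \<delta> a \<omega> g b \<theta> - sgn_idx i *
    orbit_inf (if i = 4 then a\<^sup>2 else a) (if i = 4 then 2 * \<omega> else \<omega>) (lambda0 i \<delta> a \<omega> g b) \<theta>"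
proof -
  define A where "A = (if i = 4 then a\<^sup>2 else a)"
  define \<Omega> where "\<Omega> = (if i = 4 then 2 * \<omega> else \<omega>)"
  have A: "A > 0"
    using i a_pos a_neg by (auto simp: A_def)
  let ?f = "lambda0 i \<delta> a \<omega> g b"
  define u where "u = rec_nat ?f (\<lambda>n v \<theta>. min (A * v (\<theta> - \<Omega>)) (?f \<theta>))"
  have u0: "u 0 \<theta> = ?f \<theta>" and uS: "u (Suc n) \<theta> = min (A * u n (\<theta> - \<Omega>)) (?f \<theta>)" for n \<theta>
    by (simp_all add: u_def)
  have u: "0 \<le> u n \<theta> \<and> u n \<theta> \<le> ?f \<theta>" for n \<theta>
    by (induction n arbitrary: \<theta>) (use A pos in \<open>auto simp: u0 uS\<close>)
  have phi: "phi i \<delta> a \<omega> g b n = (\<lambda>\<theta>. mu i \<delta> a \<omega> g b \<theta> - sgn_idx i * u n \<theta>)" for n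
  proof (induction n)
    case 0
    then show ?case
      by (auto simp: phi_def u0 phi0_eq)
  next
    case (Suc n)
    have "phi i \<delta> a \<omega> g b (Suc n) = curve_step i \<delta> a \<omega> g b (phi i \<delta> a \<omega> g b n)"
      by (simp add: phi_def)
    then show ?case
      using curve_step_eq[OF b pos, of "u n"] u by (simp add: Suc uS A_def \<Omega>_def)
  qed
  have "(\<lambda>n. phi i \<delta> a \<omega> g b n \<theta>) \<longlonglongrightarrow> mu i \<delta> a \<omega> g b \<theta> - sgn_idx i * orbit_inf A \<Omega> ?f \<theta>"
    unfolding phi by (intro tendsto_intros capped_iteration_tendsto A pos u0 uS)
  then show ?thesis
    unfolding phi_inf_def A_def \<Omega>_def by (rule limI)
qed

text \<open>The two additional collisions are excluded by signs, because \<open>g\<close> is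
  nonnegative: \<open>gamma1_tilde < 0 \<le> mu\<close> for \<open>i = 1\<close>, and
  \<open>mu2_hat < 0 \<le> phi0\<close> for \<open>i = 2\<close>.\<close>

lemma curves_collide_iff:
  assumes "b > 0"
  shows "curves_collide i \<delta> a \<omega> g b \<longleftrightarrow> (\<exists>\<theta>. lambda0 i \<delta> a \<omega> g b \<theta> = 0)"
proof -
  have m: "b * twisted_sum a \<omega> g \<theta> \<ge> 0" if "i \<noteq> 4" for \<theta>
    using twisted_sum_nonneg[OF abs_slope_gt_1 per cont _ g] a_pos assms that i by auto
  have bg: "b * g \<theta> \<ge> 0" for \<theta>
    using g assms by simp
  have "gamma1_tilde \<omega> g b \<theta> \<noteq> mu i \<delta> a \<omega> g b \<theta>" if "i = 1" for \<theta>
  proof -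
    have "gamma1_tilde \<omega> g b \<theta> < 0"
      using bg[of "\<theta> - \<omega>"] pi_gt_zero unfolding gamma1_tilde_def by linarith
    moreover have "mu i \<delta> a \<omega> g b \<theta> \<ge> 0"
      unfolding mu_eq using m that by (simp add: curve_offset_def sgn_idx_def)
    ultimately show ?thesis
      by simp
  qed
  moreover have "phi0 i \<omega> g b \<theta> \<noteq> mu2_hat \<delta> a \<omega> g b \<theta>" if "i = 2" for \<theta>
  proof -
    have "mu2_hat \<delta> a \<omega> g b \<theta> < 0"
    proof -
      have "a * \<delta> / (a - 1) > 0"
        using a_pos \<delta> that by simp
      then show ?thesis
        unfolding mu2_hat_eq using m[of \<theta>] that by linarith
    qed
    moreover have "phi0 i \<omega> g b \<theta> \<ge> 0"
      using bg that by (simp add: phi0_def)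
    ultimately show ?thesis
      by simp
  qed
  moreover have "lambda0 i \<delta> a \<omega> g b \<theta> = 0 \<longleftrightarrow> phi0 i \<omega> g b \<theta> = mu i \<delta> a \<omega> g b \<theta>" for \<theta>
    by (auto simp: lambda0_def)
  ultimately show ?thesis
    unfolding curves_collide_def graphs_meet_def by blast
qed

end

section \<open>Zeros of finite order\<close>

text \<open>A local lower bound of Lojasiewicz type, the common consequence of the analytic and of
  the even-order assumption.\<close>

definition finite_order_zeros :: "(real \<Rightarrow> real) \<Rightarrow> bool" where
  "finite_order_zeros f \<longleftrightarrow>
     (\<forall>z. f z = 0 \<longrightarrow> (\<exists>k n r. k > 0 \<and> r > 0 \<and> (\<forall>t. \<bar>t\<bar> < r \<longrightarrow> k * \<bar>t\<bar> ^ n \<le> \<bar>f (z + t)\<bar>)))"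

text \<open>Away from the zeros continuity gives the same kind of bound with exponent 0, so
  compactness of a period yields finitely many centres. Cover radii of at most 1 allow all the
  exponents to be raised to a common \<open>N\<close>.\<close>

lemma finite_order_zeros_uniform:
  assumes per: "circle_fun f" and cont: "continuous_on UNIV f"
    and nonneg: "\<And>\<theta>. f \<theta> \<ge> 0" and ord: "finite_order_zeros f"
  obtains X c N where "finite X" "c > 0" "N > (0::nat)"
    "\<And>\<theta>. \<exists>x\<in>X. \<exists>j::int. c * \<bar>\<theta> - (x + 2 * pi * of_int j)\<bar> ^ N \<le> f \<theta>"
proof -
  have "\<exists>c n r. c > 0 \<and> r > 0 \<and> (\<forall>t. \<bar>t\<bar> < r \<longrightarrow> c * \<bar>t\<bar> ^ n \<le> f (x + t))" for x
  proof (cases "f x = 0")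
    case True
    then show ?thesis
      using ord nonneg unfolding finite_order_zeros_def by simp
  next
    case False
    then have pos: "f x / 2 > 0"
      using nonneg[of x] by simp
    have "isCont f x"
      using cont by (simp add: continuous_on_eq_continuous_at)
    then obtain r where r: "r > 0" "\<And>y. dist y x < r \<Longrightarrow> dist (f y) (f x) < f x / 2"
      using pos unfolding continuous_at_eps_delta by (metis (no_types))
    have "f x / 2 * \<bar>t\<bar> ^ 0 \<le> f (x + t)" if "\<bar>t\<bar> < r" for t
    proof -
      have "\<bar>f (x + t) - f x\<bar> < f x / 2"
        using r(2)[of "x + t"] that by (simp add: dist_real_def)
      then have "f x / 2 \<le> f (x + t)"
        unfolding abs_less_iff by linarith
      then show ?thesis
        by simp
    qed
    then show ?thesis
      using pos r(1) by blast
  qed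
  then obtain c n r where c: "\<And>x. c x > (0::real)" and r: "\<And>x. r x > (0::real)"
    and le: "\<And>x t. \<bar>t\<bar> < r x \<Longrightarrow> c x * \<bar>t\<bar> ^ n x \<le> f (x + t)"
    by metis
  obtain X where X: "finite X" "{0..2 * pi} \<subseteq> (\<Union>x\<in>X. ball x (min (r x) 1))"
  proof (rule compactE_image[of "{0..2 * pi}" "{0..2 * pi}" "\<lambda>x. ball x (min (r x) 1)"])
    show "{0..2 * pi} \<subseteq> (\<Union>x\<in>{0..2 * pi}. ball x (min (r x) 1))"
      using r by force
  qed auto
  have "X \<noteq> {}"
    using X(2) by auto
  define c0 where "c0 = Min (c ` X)"
  \<comment> \<open>The \<open>Suc\<close> makes \<open>N\<close> positive, as \<open>root N\<close>
    requires later.\<close>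
  define N where "N = Suc (Max (n ` X))"
  show ?thesis
  proof
    show "finite X" by fact
    show "c0 > 0"
      using c X(1) \<open>X \<noteq> {}\<close> by (simp add: c0_def)
    show "N > 0"
      by (simp add: N_def)
    fix \<theta>
    obtain j y where y: "\<theta> = y + 2 * pi * of_int j" "y \<in> {0..2 * pi}"
      by (rule circle_representative)
    then obtain x where x: "x \<in> X" "\<bar>y - x\<bar> < r x" "\<bar>y - x\<bar> < 1"
      using X(2) by (auto simp: dist_real_def abs_minus_commute)
    have "n x \<le> Max (n ` X)"
      using X(1) x(1) by simp
    then have "\<bar>y - x\<bar> ^ N \<le> \<bar>y - x\<bar> ^ n x"
      using x(3) by (intro power_decreasing) (auto simp: N_def)
    moreover have "c0 \<le> c x"
      using X(1) x(1) by (simp add: c0_def)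
    ultimately have "c0 * \<bar>y - x\<bar> ^ N \<le> c x * \<bar>y - x\<bar> ^ n x"
      using c[of x] by (intro mult_mono) auto
    also have "\<dots> \<le> f \<theta>"
      using le[OF x(2)] circle_fun_shift_int[OF per] by (simp add: y(1))
    finally have "c0 * \<bar>\<theta> - (x + 2 * pi * of_int j)\<bar> ^ N \<le> f \<theta>"
      by (simp add: y(1))
    then show "\<exists>x\<in>X. \<exists>j::int. c0 * \<bar>\<theta> - (x + 2 * pi * of_int j)\<bar> ^ N \<le> f \<theta>"
      using x(1) by blast
  qed
qed

section \<open>Points that avoid the shrinking neighbourhoods of all orbits of zeros\<close>

text \<open>The excluded balls have total length at most
  \<open>2 * card X * \<epsilon> / (1 - q)\<close>, which the choice of \<epsilon> makes smaller
  than \<open>v - u\<close>, so they cannot cover the interval.\<close>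

lemma exists_point_far_from_orbits:
  fixes p :: "nat \<Rightarrow> 'x \<Rightarrow> real"
  assumes uv: "u < v" and q: "0 \<le> q" "q < 1" and X: "finite X"
  obtains \<epsilon> \<theta> where "0 < \<epsilon>" "\<epsilon> \<le> 1" "\<theta> \<in> {u..v}"
    "\<And>k x. x \<in> X \<Longrightarrow> \<epsilon> * q ^ k \<le> \<bar>\<theta> - p k x\<bar>"
proof -
  \<comment> \<open>The summand 1 beside \<open>card X\<close> covers an empty \<open>X\<close>; the
    bound 1 keeps every excluded ball within distance 1 of its centre.\<close>
  define \<epsilon> where "\<epsilon> = min 1 ((v - u) * (1 - q) / (4 * (real (card X) + 1)))"
  have \<epsilon>: "0 < \<epsilon>" "\<epsilon> \<le> 1"
    using uv q by (auto simp: \<epsilon>_def)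
  define D where "D k = (\<Union>x\<in>X. ball (p k x) (\<epsilon> * q ^ k))" for k
  have D_open: "open (D k)" for k
    by (auto simp: D_def)
  have D: "emeasure lborel (D k) \<le> ennreal (2 * real (card X) * \<epsilon> * q ^ k)" for k
  proof -
    have "emeasure lborel (D k) \<le> (\<Sum>x\<in>X. emeasure lborel (ball (p k x) (\<epsilon> * q ^ k)))"
      unfolding D_def using X by (intro emeasure_subadditive_finite) auto
    also have "\<dots> = (\<Sum>x\<in>X. ennreal (2 * (\<epsilon> * q ^ k)))"
      using \<epsilon> q by (intro sum.cong) (auto simp: ball_eq_greaterThanLessThan)
    also have "\<dots> = ennreal (2 * real (card X) * \<epsilon> * q ^ k)"
      using \<epsilon> q by (simp add: ennreal_of_nat_eq_real_of_nat ennreal_mult[symmetric] mult_ac)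
    finally show ?thesis .
  qed
  have "\<not> {u..v} \<subseteq> (\<Union>k. D k)"
  proof
    assume "{u..v} \<subseteq> (\<Union>k. D k)"
    then have "emeasure lborel {u..v} \<le> emeasure lborel (\<Union>k. D k)"
      using D_open by (intro emeasure_mono) auto
    also have "\<dots> \<le> (\<Sum>k. emeasure lborel (D k))"
      using D_open by (intro emeasure_subadditive_countably) auto
    also have "\<dots> \<le> (\<Sum>k. ennreal (2 * real (card X) * \<epsilon> * q ^ k))"
      using D by (intro suminf_le) auto
    also have "\<dots> = ennreal (\<Sum>k. 2 * real (card X) * \<epsilon> * q ^ k)"
      using \<epsilon> q by (intro suminf_ennreal2 summable_mult summable_geometric) auto
    also have "(\<Sum>k. 2 * real (card X) * \<epsilon> * q ^ k) = 2 * real (card X) * \<epsilon> * (1 / (1 - q))"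
      using q by (subst suminf_mult) (auto intro: summable_geometric simp: suminf_geometric)
    finally have "v - u \<le> 2 * real (card X) * \<epsilon> * (1 / (1 - q))"
      using uv q \<epsilon> by simp
    also have "\<dots> \<le> 2 * real (card X) * ((v - u) * (1 - q) / (4 * (real (card X) + 1))) * (1 / (1 - q))"
      using q by (intro mult_right_mono mult_left_mono) (auto simp: \<epsilon>_def)
    also have "\<dots> = (v - u) * (2 * real (card X) / (4 * (real (card X) + 1)))"
      using q by simp
    also have "\<dots> < (v - u) * 1"
      using uv by (intro mult_strict_left_mono) auto
    finally show False
      by simp
  qed
  then obtain \<theta> where "\<theta> \<in> {u..v}" "\<And>k. \<theta> \<notin> D k"
    by blast
  then show ?thesis
    using \<epsilon> by (intro that[of \<epsilon> \<theta>]) (auto simp: D_def dist_real_def abs_minus_commute not_less)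
qed

text \<open>
  The points where the \<open>k\<close>-th term is below \<open>\<eta>\<close> have measure \<open>O ((\<eta> / A ^ k) powr (1 / N))\<close>,
  which is summable over \<open>k\<close> with a small sum for small \<open>\<eta>\<close>.
\<close>

lemma orbit_growth_dominates:
  assumes per: "circle_fun f" and cont: "continuous_on UNIV f"
    and nonneg: "\<And>\<theta>. f \<theta> \<ge> 0" and ord: "finite_order_zeros f"
    and A: "A > 1" and uv: "u < v"
  obtains \<theta> \<eta> where "\<theta> \<in> {u..v}" "\<eta> > 0" "\<And>k. \<eta> \<le> A ^ k * f (\<theta> - real k * \<Omega>)"
proof -
  obtain X c N where X: "finite X" and c: "c > 0" and N: "N > (0::nat)"
    and lower: "\<And>\<theta>. \<exists>x\<in>X. \<exists>j::int. c * \<bar>\<theta> - (x + 2 * pi * of_int j)\<bar> ^ N \<le> f \<theta>"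
    by (rule finite_order_zeros_uniform[OF per cont nonneg ord]) (use that in blast)
  \<comment> \<open>With \<open>q ^ N = 1 / A\<close> the growth \<open>A ^ k\<close> cancels the
    shrinking of the radii exactly:
    \<open>A ^ k * (\<epsilon> * q ^ k) ^ N = \<epsilon> ^ N\<close>.\<close>
  define q where "q = root N (1 / A)"
  have q: "0 \<le> q" "q < 1" "q ^ N = 1 / A"
    using A N by (auto simp: q_def)
  \<comment> \<open>With \<open>w \<le> u + 1\<close> the window from \<open>u - 1\<close> to
    \<open>w + 1\<close> has length at most 3, below \<open>2 * pi\<close>, so it contains at most
    one translate of each point.\<close>
  define w where "w = min v (u + 1)"
  define near where "near k x j \<longleftrightarrow> u - 1 < x + real k * \<Omega> + 2 * pi * of_int j \<and>
    x + real k * \<Omega> + 2 * pi * of_int j < w + 1" for k x and j :: int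
  \<comment> \<open>One translate per orbit point suffices for the measure estimate. If none lies in
    the window, the arbitrary value of \<open>SOME\<close> does no harm.\<close>
  define p where "p k x = x + real k * \<Omega> + 2 * pi * of_int (SOME j. near k x j)" for k x
  obtain \<epsilon> \<theta> where \<epsilon>: "0 < \<epsilon>" "\<epsilon> \<le> 1" and \<theta>: "\<theta> \<in> {u..w}"
    and far: "\<And>k x. x \<in> X \<Longrightarrow> \<epsilon> * q ^ k \<le> \<bar>\<theta> - p k x\<bar>"
    using exists_point_far_from_orbits[of u w q X p] uv q X by (auto simp: w_def)
  \<comment> \<open>A translate violating the bound would be within 1 of \<theta>, hence in the
    window, hence the one chosen by \<open>p\<close>.\<close>
  have far_all: "\<epsilon> * q ^ k \<le> \<bar>\<theta> - (x + real k * \<Omega> + 2 * pi * of_int j)\<bar>"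
    if "x \<in> X" for k x and j :: int
  proof (rule ccontr)
    assume less: "\<not> ?thesis"
    have "\<epsilon> * q ^ k \<le> 1 * 1"
      using \<epsilon> q by (intro mult_mono power_le_one) auto
    then have "near k x j"
      using less \<theta> unfolding near_def atLeastAtMost_iff by linarith
    then have "near k x (SOME j. near k x j)"
      by (rule someI)
    then have "\<bar>2 * pi * (of_int j - of_int (SOME j. near k x j))\<bar> < w - u + 2"
      using \<open>near k x j\<close> unfolding near_def right_diff_distrib by linarith
    then have "2 * pi * \<bar>of_int j - of_int (SOME j. near k x j)\<bar> < 3"
      by (simp add: abs_mult w_def)
    moreover have "2 * pi * 1 \<le> 2 * pi * \<bar>of_int j - of_int (SOME j. near k x j) :: real\<bar>"
      if "j \<noteq> (SOME j. near k x j)"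
    proof (rule mult_left_mono)
      have "(1::int) \<le> \<bar>j - (SOME j. near k x j)\<bar>"
        using that by linarith
      then have "of_int 1 \<le> (of_int \<bar>j - (SOME j. near k x j)\<bar> :: real)"
        by (rule of_int_le_iff[THEN iffD2])
      then show "1 \<le> \<bar>of_int j - of_int (SOME j. near k x j) :: real\<bar>"
        by simp
    qed simp
    ultimately have "j = (SOME j. near k x j)"
      using pi_ge_two by fastforce
    then show False
      using far[OF that, of k] less by (simp add: p_def)
  qed
  show ?thesis
  proof
    show "\<theta> \<in> {u..v}"
      using \<theta> by (simp add: w_def)
    show "c * \<epsilon> ^ N > 0"
      using c \<epsilon> by simp
    fix k
    obtain x j where x: "x \<in> X"
      and le: "c * \<bar>\<theta> - real k * \<Omega> - (x + 2 * pi * of_int j)\<bar> ^ N \<le> f (\<theta> - real k * \<Omega>)"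
      using lower by blast
    have eq: "\<theta> - real k * \<Omega> - (x + 2 * pi * of_int j) = \<theta> - (x + real k * \<Omega> + 2 * pi * of_int j)"
      by simp
    have "c * \<epsilon> ^ N = A ^ k * (c * (\<epsilon> * q ^ k) ^ N)"
      using A by (simp add: power_mult_distrib power_mult[symmetric] mult.commute[of k])
        (simp add: power_mult q power_divide)
    also have "\<dots> \<le> A ^ k * (c * \<bar>\<theta> - real k * \<Omega> - (x + 2 * pi * of_int j)\<bar> ^ N)"
      unfolding eq using far_all[OF x] A c \<epsilon> q by (intro mult_left_mono power_mono) auto
    also have "\<dots> \<le> A ^ k * f (\<theta> - real k * \<Omega>)"
      using le A by (intro mult_left_mono) auto
    finally show "c * \<epsilon> ^ N \<le> A ^ k * f (\<theta> - real k * \<Omega>)" .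
  qed
qed

text \<open>By continuity at the zero, \<open>q\<close> stays above half of its value there.\<close>

lemma even_order_zeros_finite:
  assumes "\<And>z. f z = 0 \<Longrightarrow> even_order_zero f z"
  shows "finite_order_zeros f"
  unfolding finite_order_zeros_def
proof (intro allI impI)
  fix z assume "f z = 0"
  then obtain \<epsilon> m q where \<epsilon>: "\<epsilon> > 0" and q: "continuous_on {z - \<epsilon> <..< z + \<epsilon>} q"
    and f: "\<And>\<theta>. \<theta> \<in> {z - \<epsilon> <..< z + \<epsilon>} \<Longrightarrow> f \<theta> = (\<theta> - z) ^ m * q \<theta> \<and> q \<theta> > 0"
    using assms unfolding even_order_zero_def by metis
  have qz: "q z / 2 > 0"
    using f[of z] \<epsilon> by simp
  have "isCont q z"
    using q \<epsilon> by (simp add: continuous_on_eq_continuous_at)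
  then obtain d where d: "d > 0" "\<And>y. dist y z < d \<Longrightarrow> dist (q y) (q z) < q z / 2"
    using qz unfolding continuous_at_eps_delta by (metis (no_types))
  have "q z / 2 * \<bar>t\<bar> ^ m \<le> \<bar>f (z + t)\<bar>" if "\<bar>t\<bar> < min d \<epsilon>" for t
  proof -
    have "f (z + t) = t ^ m * q (z + t)" "q (z + t) > 0"
      using f[of "z + t"] that by (auto simp: abs_less_iff)
    moreover have "q z / 2 \<le> q (z + t)"
    proof -
      have "\<bar>q (z + t) - q z\<bar> < q z / 2"
        using d(2)[of "z + t"] that by (simp add: dist_real_def)
      then show ?thesis
        unfolding abs_less_iff by linarith
    qed
    ultimately show ?thesis
      using mult_right_mono[of "q z / 2" "q (z + t)" "\<bar>t\<bar> ^ m"]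
      by (simp add: abs_mult power_abs mult.commute)
  qed
  then show "\<exists>k n r. k > 0 \<and> r > 0 \<and> (\<forall>t. \<bar>t\<bar> < r \<longrightarrow> k * \<bar>t\<bar> ^ n \<le> \<bar>f (z + t)\<bar>)"
    using qz d(1) \<epsilon> by (intro exI[of _ "q z / 2"] exI[of _ m] exI[of _ "min d \<epsilon>"]) auto
qed

section \<open>Finite order of zeros in the analytic case\<close>

text \<open>The extension is recentred at 0, so that all base points \<open>x + k * \<omega>\<close>
  share one disc and their extensions can be summed.\<close>

definition complex_extension :: "real \<Rightarrow> (real \<Rightarrow> real) \<Rightarrow> real \<Rightarrow> (complex \<Rightarrow> complex) \<Rightarrow> bool" where
  "complex_extension \<rho> f x P \<longleftrightarrow> P holomorphic_on ball 0 \<rho> \<and>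
     (\<forall>t. \<bar>t\<bar> < \<rho> \<longrightarrow> P (of_real t) = of_real (f (x + t)))"

text \<open>The real Taylor coefficients, read as complex ones, have the same radius of convergence.
  Choosing \<open>r\<close> strictly inside it makes the sum bounded on the closed disc.\<close>

lemma real_analytic_local_extension:
  assumes "real_analytic f"
  obtains r C P where "r > 0" "complex_extension r f x P" "\<And>z. z \<in> ball 0 r \<Longrightarrow> cmod (P z) \<le> C"
proof -
  obtain S where S: "(\<lambda>t. f (x + t)) has_fps_expansion S"
    using assms unfolding real_analytic_def by blast
  define T where "T = Abs_fps (\<lambda>n. complex_of_real (fps_nth S n))"
  have radius: "fps_conv_radius T = fps_conv_radius S"
    by (simp add: fps_conv_radius_def conv_radius_def T_def)
  have "fps_conv_radius S > 0" and "\<forall>\<^sub>F t in nhds 0. eval_fps S t = f (x + t)"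
    using S by (auto simp: has_fps_expansion_def)
  then obtain d where d: "d > 0" "\<And>t. \<bar>t\<bar> < d \<Longrightarrow> eval_fps S t = f (x + t)"
    by (auto simp: eventually_nhds_metric dist_real_def)
  obtain s where s: "s > 0" "ereal s < fps_conv_radius S"
    using \<open>fps_conv_radius S > 0\<close> ereal_dense2[of 0 "fps_conv_radius S"] by (auto simp: zero_ereal_def)
  define r where "r = min d s"
  have r: "r > 0" "ereal r < fps_conv_radius S" "r \<le> d"
    using d(1) s by (auto simp: r_def min_def intro: le_less_trans[OF _ s(2)])
  have sub: "cball 0 r \<subseteq> eball (0::complex) (fps_conv_radius T)"
  proof
    fix w :: complex assume "w \<in> cball 0 r"
    then have "ereal (cmod w) \<le> ereal r"
      by simp
    then show "w \<in> eball 0 (fps_conv_radius T)"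
      unfolding radius in_eball_iff dist_0_norm using r(2) by (rule le_less_trans)
  qed
  have "bounded (eval_fps T ` cball 0 r)"
    using continuous_on_subset[OF continuous_on_eval_fps sub]
    by (intro compact_imp_bounded compact_continuous_image) auto
  then obtain C where C: "\<And>z. z \<in> cball 0 r \<Longrightarrow> cmod (eval_fps T z) \<le> C"
    unfolding bounded_iff by (metis imageI)
  have "eval_fps T (of_real t) = of_real (f (x + t))" if "\<bar>t\<bar> < r" for t
  proof -
    have "ereal (norm t) < ereal r"
      using that by simp
    then have "ereal (norm t) < fps_conv_radius S"
      using r(2) by (rule less_trans)
    then have "(\<lambda>n. of_real (fps_nth S n * t ^ n) :: complex) sums of_real (eval_fps S t)"
      by (intro sums_of_real sums_eval_fps)
    then have "eval_fps T (of_real t) = of_real (eval_fps S t)"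
      unfolding eval_fps_def[of T] by (simp add: T_def sums_iff)
    then show ?thesis
      using d(2) that r(3) by simp
  qed
  moreover have "eval_fps T holomorphic_on ball 0 r"
    by (rule holomorphic_on_eval_fps) (use sub ball_subset_cball in blast)
  ultimately have "complex_extension r f x (eval_fps T)"
    by (simp add: complex_extension_def)
  then show ?thesis
    using r(1) C by (intro that[of r "eval_fps T" C]) auto
qed

text \<open>A finite cover of a period by discs of half the local radius leaves room to recentre the
  extensions with a common radius. The common bound serves to sum them.\<close>

lemma real_analytic_uniform_extension:
  assumes per: "circle_fun f" and "real_analytic f"
  obtains \<rho> C where "\<rho> > 0" "\<And>x. \<exists>P. complex_extension \<rho> f x P \<and> (\<forall>z\<in>ball 0 \<rho>. cmod (P z) \<le> C)"
proof -
  have "\<exists>r C P. r > 0 \<and> complex_extension r f x P \<and> (\<forall>z\<in>ball 0 r. cmod (P z) \<le> C)" for x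
    using real_analytic_local_extension[OF assms(2), of x] by metis
  then obtain r C P where r: "\<And>x. r x > 0" and P: "\<And>x. complex_extension (r x) f x (P x)"
    and C: "\<And>x z. z \<in> ball 0 (r x) \<Longrightarrow> cmod (P x z) \<le> C x"
    by metis
  obtain X where X: "finite X" "{0..2 * pi} \<subseteq> (\<Union>x\<in>X. ball x (r x / 2))"
  proof (rule compactE_image[of "{0..2 * pi}" "{0..2 * pi}" "\<lambda>x. ball x (r x / 2)"])
    show "{0..2 * pi} \<subseteq> (\<Union>x\<in>{0..2 * pi}. ball x (r x / 2))"
      using r by force
  qed auto
  have "X \<noteq> {}"
    using X(2) by auto
  define \<rho> where "\<rho> = Min ((\<lambda>x. r x / 2) ` X)"
  have "\<rho> > 0"
    using r X(1) \<open>X \<noteq> {}\<close> by (simp add: \<rho>_def)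
  moreover have "\<exists>Q. complex_extension \<rho> f \<theta> Q \<and> (\<forall>z\<in>ball 0 \<rho>. cmod (Q z) \<le> Max (C ` X))" for \<theta>
  proof -
    obtain j y where y: "\<theta> = y + 2 * pi * of_int j" "y \<in> {0..2 * pi}"
      by (rule circle_representative)
    then obtain x where x: "x \<in> X" "\<bar>y - x\<bar> < r x / 2"
      using X(2) by (auto simp: dist_real_def abs_minus_commute)
    have "\<rho> \<le> r x / 2"
      unfolding \<rho>_def using X(1) x(1) by (intro Min_le) auto
    have in_ball: "z + of_real (y - x) \<in> ball 0 (r x)" if "z \<in> ball 0 \<rho>" for z :: complex
    proof -
      have "cmod (z + of_real (y - x)) \<le> cmod z + \<bar>y - x\<bar>"
        by (metis norm_triangle_ineq norm_of_real)
      then show ?thesis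
        using that x(2) \<open>\<rho> \<le> r x / 2\<close> by simp
    qed
    define Q where "Q z = P x (z + of_real (y - x))" for z
    have "Q holomorphic_on ball 0 \<rho>"
      unfolding Q_def[abs_def]
    proof (rule holomorphic_on_compose_gen[of _ _ "P x", unfolded o_def])
      show "P x holomorphic_on ball 0 (r x)"
        using P by (simp add: complex_extension_def)
    qed (use in_ball in \<open>auto intro!: holomorphic_intros\<close>)
    moreover have "Q (of_real t) = of_real (f (\<theta> + t))" if "\<bar>t\<bar> < \<rho>" for t
    proof -
      have "\<bar>t + (y - x)\<bar> < r x"
        using that x(2) \<open>\<rho> \<le> r x / 2\<close> by linarith
      then have "P x (of_real (t + (y - x))) = of_real (f (x + (t + (y - x))))"
        using P unfolding complex_extension_def by blast
      moreover have "f (\<theta> + t) = f (y + t)"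
        using circle_fun_shift_int[OF per, of "y + t" j] by (simp add: y(1) algebra_simps)
      ultimately show ?thesis
        by (simp add: Q_def algebra_simps)
    qed
    moreover have "cmod (Q z) \<le> Max (C ` X)" if "z \<in> ball 0 \<rho>" for z
      using C[OF in_ball[OF that]] X(1) x(1) unfolding Q_def
      by (intro order.trans[OF _ Max_ge[of "C ` X" "C x"]]) auto
    ultimately show ?thesis
      unfolding complex_extension_def by blast
  qed
  ultimately show ?thesis
    by (rule that)
qed

text \<open>The extensions at \<open>x + k * \<omega>\<close>, divided by \<open>a ^ Suc k\<close>,
  are dominated by a geometric series, and a uniform limit of holomorphic functions is
  holomorphic.\<close>

lemma twisted_sum_extension:
  assumes a: "\<bar>a\<bar> > 1" and per: "circle_fun g" and cont: "continuous_on UNIV g"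
    and ext: "\<And>x. \<exists>P. complex_extension \<rho> g x P \<and> (\<forall>z\<in>ball 0 \<rho>. cmod (P z) \<le> C)"
  shows "\<exists>Q. complex_extension \<rho> (twisted_sum a \<omega> g) x Q"
proof -
  obtain P where P: "\<And>x. complex_extension \<rho> g x (P x)"
    and C: "\<And>x z. z \<in> ball 0 \<rho> \<Longrightarrow> cmod (P x z) \<le> C"
    using ext by metis
  define F where "F k z = P (x + real k * \<omega>) z / of_real (a ^ Suc k)" for k z
  define Q where "Q z = (\<Sum>k. F k z)" for z
  have "cmod (F k z) \<le> C / \<bar>a\<bar> ^ Suc k" if "z \<in> ball 0 \<rho>" for k z
    using C[OF that] unfolding F_def norm_divide norm_of_real power_abs
    by (intro divide_right_mono) auto
  then have lim: "uniform_limit (ball 0 \<rho>) (\<lambda>n z. \<Sum>k<n. F k z) Q sequentially"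
    unfolding Q_def by (rule Weierstrass_m_test[OF _ summable_geometric_abs[OF a per cont]])
  have "Q holomorphic_on ball 0 \<rho>"
  proof (rule holomorphic_uniform_sequence[OF open_ball])
    show "(\<lambda>z. \<Sum>k<n. F k z) holomorphic_on ball 0 \<rho>" for n
      unfolding F_def using P a
      by (intro holomorphic_intros) (auto simp: complex_extension_def)
    show "\<exists>d>0. cball z d \<subseteq> ball 0 \<rho> \<and> uniform_limit (cball z d) (\<lambda>n z. \<Sum>k<n. F k z) Q sequentially"
      if "z \<in> ball 0 \<rho>" for z
      using open_contains_cball[of "ball 0 \<rho>"] that uniform_limit_on_subset[OF lim] by (meson open_ball)
  qed
  moreover have "Q (of_real t) = of_real (twisted_sum a \<omega> g (x + t))" if "\<bar>t\<bar> < \<rho>" for t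
  proof -
    have "F k (of_real t) = of_real (g (x + t + real k * \<omega>) / a ^ Suc k)" for k
      using P[of "x + real k * \<omega>"] that
      by (simp add: F_def complex_extension_def algebra_simps)
    then show ?thesis
      unfolding Q_def twisted_sum_def
      by (simp only: suminf_of_real[OF twisted_sum_summable[OF a per cont], symmetric])
  qed
  ultimately show ?thesis
    unfolding complex_extension_def by blast
qed

text \<open>A holomorphic function that is not identically zero on the disc vanishes to finite order
  at 0, which bounds it from below by a power.\<close>

lemma complex_extension_zero_dichotomy:
  assumes \<rho>: "\<rho> > 0" and P: "complex_extension \<rho> f z P" and z: "f z = 0"
  shows "(\<forall>t. \<bar>t\<bar> < \<rho> \<longrightarrow> f (z + t) = 0) \<or>
    (\<exists>k n r. k > 0 \<and> r > 0 \<and> (\<forall>t. \<bar>t\<bar> < r \<longrightarrow> k * \<bar>t\<bar> ^ n \<le> \<bar>f (z + t)\<bar>))"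
proof (cases "\<forall>w\<in>ball 0 \<rho>. P w = 0")
  case True
  then have "f (z + t) = 0" if "\<bar>t\<bar> < \<rho>" for t
    using P that unfolding complex_extension_def
    by (metis mem_ball_0 norm_of_real of_real_eq_0_iff)
  then show ?thesis
    by blast
next
  case False
  have P0: "P 0 = 0"
    using P \<rho> z unfolding complex_extension_def by (metis abs_zero add.right_neutral of_real_0)
  obtain w where w: "w \<in> ball 0 \<rho>" "P w \<noteq> P 0"
    using False P0 by auto
  have hol: "P holomorphic_on ball 0 \<rho>"
    using P by (simp add: complex_extension_def)
  obtain k n r where k: "k > 0" and r: "r > 0" "ball 0 r \<subseteq> ball (0::complex) \<rho>"
    and le: "\<And>w. w \<in> ball 0 r \<Longrightarrow> k * norm (w - 0) ^ n \<le> norm (P w - P 0)"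
    by (rule holomorphic_lower_bound_difference[OF hol open_ball connected_ball _ w])
      (use \<rho> in auto)
  have "k * \<bar>t\<bar> ^ n \<le> \<bar>f (z + t)\<bar>" if "\<bar>t\<bar> < r" for t
  proof -
    have t: "of_real t \<in> ball (0::complex) r"
      using that by simp
    then have "\<bar>t\<bar> < \<rho>"
      using r(2) by (metis mem_ball_0 norm_of_real subsetD)
    then have "P (of_real t) = of_real (f (z + t))"
      using P unfolding complex_extension_def by blast
    then show ?thesis
      using le[OF t] P0 by simp
  qed
  then show ?thesis
    using k r(1) by blast
qed

text \<open>If \<open>f\<close> vanishes on an interval of radius \<rho> about \<open>x\<close>, it
  vanishes near \<open>x + \<rho> / 2\<close>, which rules out a power bound there; so that point is
  flat too. Repeating this, \<open>f\<close> vanishes everywhere to the right of \<open>z\<close>,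
  and by periodicity also at \<open>y\<close>.\<close>

lemma complex_extension_finite_order_zeros:
  assumes \<rho>: "\<rho> > 0" and ext: "\<And>x. \<exists>P. complex_extension \<rho> f x P"
    and per: "circle_fun f" and nz: "f y \<noteq> 0"
  shows "finite_order_zeros f"
proof (rule ccontr)
  define flat where "flat x \<longleftrightarrow> (\<forall>t. \<bar>t\<bar> < \<rho> \<longrightarrow> f (x + t) = 0)" for x
  have dich: "flat z \<or> (\<exists>k n r. k > 0 \<and> r > 0 \<and> (\<forall>t. \<bar>t\<bar> < r \<longrightarrow> k * \<bar>t\<bar> ^ n \<le> \<bar>f (z + t)\<bar>))"
    if "f z = 0" for z
  proof -
    obtain P where "complex_extension \<rho> f z P"
      using ext by blast
    from complex_extension_zero_dichotomy[OF \<rho> this that] show ?thesis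
      unfolding flat_def .
  qed
  assume "\<not> finite_order_zeros f"
  then obtain z where "flat z"
    using dich unfolding finite_order_zeros_def by blast
  have step: "flat (x + \<rho> / 2)" if "flat x" for x
  proof -
    have zero: "f (x + \<rho> / 2 + t) = 0" if "\<bar>t\<bar> < \<rho> / 2" for t
      using \<open>flat x\<close>[unfolded flat_def, rule_format, of "\<rho> / 2 + t"] that by (simp add: add.assoc)
    have "\<not> (\<exists>k n r. k > 0 \<and> r > 0 \<and> (\<forall>t. \<bar>t\<bar> < r \<longrightarrow> k * \<bar>t\<bar> ^ n \<le> \<bar>f (x + \<rho> / 2 + t)\<bar>))"
    proof clarify
      fix k r :: real and n
      assume kr: "k > 0" "r > 0" and le: "\<forall>t. \<bar>t\<bar> < r \<longrightarrow> k * \<bar>t\<bar> ^ n \<le> \<bar>f (x + \<rho> / 2 + t)\<bar>"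
      define t where "t = min r (\<rho> / 2) / 2"
      have t: "t > 0" "t < r" "t < \<rho> / 2"
        using kr \<rho> by (auto simp: t_def min_def)
      then have "k * \<bar>t\<bar> ^ n \<le> 0"
        using le[rule_format, of t] zero[of t] by simp
      moreover have "k * \<bar>t\<bar> ^ n > 0"
        using kr t by simp
      ultimately show False
        by linarith
    qed
    then show ?thesis
      using dich[of "x + \<rho> / 2"] zero[of 0] \<rho> by auto
  qed
  have flat: "flat (z + real n * (\<rho> / 2))" for n
  proof (induction n)
    case (Suc n)
    have "z + real n * (\<rho> / 2) + \<rho> / 2 = z + real (Suc n) * (\<rho> / 2)"
      by (simp add: field_simps)
    then show ?case
      using step[OF Suc] by (simp only:)
  qed (use \<open>flat z\<close> in simp)
  have "f x = 0" if "x \<ge> z" for x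
  proof -
    define n where "n = nat \<lfloor>(x - z) / (\<rho> / 2)\<rfloor>"
    have "0 \<le> (x - z) / (\<rho> / 2)"
      using that \<rho> by simp
    then have "real n \<le> (x - z) / (\<rho> / 2)" "(x - z) / (\<rho> / 2) < real n + 1"
      unfolding n_def by linarith+
    then have "real n * (\<rho> / 2) \<le> x - z" "x - z < (real n + 1) * (\<rho> / 2)"
      using \<rho> by (simp_all add: pos_le_divide_eq pos_divide_less_eq)
    then have "\<bar>x - z - real n * (\<rho> / 2)\<bar> < \<rho>"
      using \<rho> unfolding distrib_right by linarith
    then show ?thesis
      using flat[of n, unfolded flat_def, rule_format, of "x - z - real n * (\<rho> / 2)"] by simp
  qed
  moreover have "z \<le> y + 2 * pi * of_int \<lceil>(z - y) / (2 * pi)\<rceil>"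
  proof -
    have "(z - y) / (2 * pi) * (2 * pi) \<le> of_int \<lceil>(z - y) / (2 * pi)\<rceil> * (2 * pi)"
      by (intro mult_right_mono) auto
    then show ?thesis
      by (simp add: mult_ac)
  qed
  ultimately show False
    using nz circle_fun_shift_int[OF per] by metis
qed

section \<open>Unbounded slopes as \<open>b\<close> tends to \<open>bs\<close>\<close>

theorem theorem3p10:
  fixes i :: nat and a \<delta> \<omega> \<tau> bs :: real and g :: "real \<Rightarrow> real" and I :: "real set"
  assumes "i \<in> {1, 2, 3, 4}"
    and "i \<in> {1, 2, 3} \<Longrightarrow> a > 1"
    and "i = 4 \<Longrightarrow> a < - 1"
    and "\<delta> > 0"
    and "\<omega> / (2 * pi) \<notin> \<rat>"
    and "circle_fun g"
    and "\<tau> > 0" and "holder_class (1 + \<tau>) g"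
    and "\<And>\<theta>. g \<theta> \<ge> 0"
    and "is_bifurcation_value i \<delta> a \<omega> g bs"
    and "(real_analytic g \<and> \<not> g constant_on UNIV) \<or>
         (\<forall>\<theta>0. lambda0 i \<delta> a \<omega> g bs \<theta>0 = 0 \<longrightarrow> even_order_zero (lambda0 i \<delta> a \<omega> g bs) \<theta>0)"
    and "is_interval I" and "\<exists>x\<in>I. \<exists>y\<in>I. x \<noteq> y"
  shows "Limsup (at_left bs) (\<lambda>b. lip_const_on I (phi_inf i \<delta> a \<omega> g b)) = \<infinity>"
proof -
  obtain Kg where Kg: "Kg \<ge> 0" "\<And>x y. \<bar>g x - g y\<bar> \<le> Kg * \<bar>x - y\<bar>"
    using holder_class_circle_lipschitz[OF assms(6,8,7)] by blast
  note per = \<open>circle_fun g\<close>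
  have cont: "continuous_on UNIV g"
    using continuous_on_lipschitz_bound Kg by blast
  note system = assms(1-4) per cont assms(9)
  have a: "\<bar>a\<bar> > 1"
    by (rule abs_slope_gt_1[OF system])
  let ?m = "twisted_sum a \<omega> g"
  define c where "c = curve_gap i \<delta> a"
  define p where "p \<theta> = a * ?m (\<theta> - \<omega>)" for \<theta>
  have c: "c > 0"
    unfolding c_def by (rule curve_gap_pos[OF system])
  have lambda0: "lambda0 i \<delta> a \<omega> g b = (\<lambda>\<theta>. c - b * p \<theta>)" for b
    unfolding c_def p_def by (rule lambda0_eq[OF system])
  have mu: "mu i \<delta> a \<omega> g b = (\<lambda>\<theta>. curve_offset i \<delta> a - sgn_idx i * b * ?m \<theta>)" for b
    by (rule mu_eq[OF system])
  have per_p: "circle_fun p"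
    using circle_fun_twisted_sum[OF a per cont, of \<omega>] unfolding circle_fun_def p_def
    by (metis add_diff_eq add.commute)
  have cont_p: "continuous_on UNIV p"
    unfolding p_def
    by (intro continuous_intros continuous_on_compose2[OF continuous_on_twisted_sum[OF a per cont]]) auto

  have bs: "bs > 0" and min: "\<And>b. b > 0 \<Longrightarrow> curves_collide i \<delta> a \<omega> g b \<Longrightarrow> bs \<le> b"
    and "curves_collide i \<delta> a \<omega> g bs"
    using assms(10) by (auto simp: is_bifurcation_value_def)
  then obtain z where z: "c - bs * p z = 0"
    using curves_collide_iff[OF system bs] lambda0 by auto
  \<comment> \<open>Otherwise \<open>lambda0\<close> would already vanish at \<theta> for the
    parameter \<open>c / p \<theta>\<close>, which is smaller than \<open>bs\<close>.\<close>
  have p_le: "bs * p \<theta> \<le> c" for \<theta>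
  proof (rule ccontr)
    assume less: "\<not> ?thesis"
    then have pos: "p \<theta> > 0"
      using bs c by (smt (verit) mult_nonneg_nonpos)
    then have "lambda0 i \<delta> a \<omega> g (c / p \<theta>) \<theta> = 0"
      by (simp add: lambda0)
    then have "curves_collide i \<delta> a \<omega> g (c / p \<theta>)"
      using curves_collide_iff[OF system] pos c by (metis divide_pos_pos)
    then have "bs \<le> c / p \<theta>"
      using min pos c by simp
    then show False
      using less pos by (simp add: pos_le_divide_eq)
  qed

  let ?f = "\<lambda>\<theta>. c - bs * p \<theta>"
  have per_f: "circle_fun ?f" and cont_f: "continuous_on UNIV ?f"
    using per_p by (auto simp: circle_fun_def intro!: continuous_intros cont_p)
  have ord: "finite_order_zeros ?f"
    using assms(11)
  proof
    assume "\<forall>\<theta>0. lambda0 i \<delta> a \<omega> g bs \<theta>0 = 0 \<longrightarrow> even_order_zero (lambda0 i \<delta> a \<omega> g bs) \<theta>0"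
    then show ?thesis
      by (intro even_order_zeros_finite) (simp add: lambda0)
  next
    assume g: "real_analytic g \<and> \<not> g constant_on UNIV"
    obtain \<rho> C where \<rho>: "\<rho> > 0"
      and ext: "\<And>x. \<exists>P. complex_extension \<rho> g x P \<and> (\<forall>z\<in>ball 0 \<rho>. cmod (P z) \<le> C)"
      using real_analytic_uniform_extension[OF per] g by metis
    have "\<exists>P. complex_extension \<rho> ?f x P" for x
    proof -
      obtain Q where "complex_extension \<rho> ?m (x - \<omega>) Q"
        using twisted_sum_extension[OF a per cont ext] by blast
      then have "complex_extension \<rho> ?f x (\<lambda>z. of_real c - of_real bs * (of_real a * Q z))"
        by (auto simp: complex_extension_def p_def add_diff_eq diff_add_eq intro!: holomorphic_intros)
      then show ?thesis
        by blast
    qed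
    \<comment> \<open>If \<open>?f\<close> vanished identically, \<open>?m\<close> would be
      constant, and its functional equation would make \<open>g\<close> constant.\<close>
    moreover have "\<exists>y. ?f y \<noteq> 0"
    proof (rule ccontr)
      assume "\<nexists>y. ?f y \<noteq> 0"
      then have "?f (\<theta> + \<omega>) = 0" for \<theta>
        by blast
      then have m: "?m \<theta> = c / bs / a" for \<theta>
        using a bs by (auto simp: p_def field_simps)
      then have "g \<theta> = a * (c / bs / a) - c / bs / a" for \<theta>
        using twisted_sum_shift[OF a per cont, of \<omega> \<theta>] unfolding m by linarith
      then show False
        using g by (auto simp: constant_on_def)
    qed
    ultimately show ?thesis
      using complex_extension_finite_order_zeros[OF \<rho> _ per_f] by blast
  qed

  define A where "A = (if i = 4 then a\<^sup>2 else a)"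
  define \<Omega> where "\<Omega> = (if i = 4 then 2 * \<omega> else \<omega>)"
  have A: "A > 1"
    using assms(1-3) one_less_power[of "\<bar>a\<bar>" 2] by (auto simp: A_def)
  have \<Omega>: "\<Omega> / (2 * pi) \<notin> \<rat>"
  proof
    assume "\<Omega> / (2 * pi) \<in> \<rat>"
    then have "\<Omega> / (2 * pi) / (if i = 4 then 2 else 1) \<in> \<rat>"
      by (rule Rats_divide) auto
    then show False
      using assms(5) by (auto simp: \<Omega>_def split: if_splits)
  qed
  \<comment> \<open>\<open>c - b * p \<theta>\<close> is \<open>b / bs\<close> times
    \<open>?f \<theta>\<close> plus \<open>1 - b / bs\<close> times \<open>c\<close>. This transfers
    lower bounds at \<open>bs\<close> to smaller parameters.\<close>
  have lambda_ge: "b / bs * ?f \<theta> \<le> c - b * p \<theta>" if "b \<le> bs" for b \<theta>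
  proof -
    have "b / bs * ?f \<theta> = b / bs * c - b * p \<theta>"
      using bs by (simp add: field_simps)
    moreover have "b / bs * c \<le> 1 * c"
      using that bs c by (intro mult_right_mono) auto
    ultimately show ?thesis
      by simp
  qed
  have lambda_nonneg: "0 \<le> c - b * p \<theta>" if "0 \<le> b" "b \<le> bs" for b \<theta>
  proof -
    have "0 \<le> b / bs * ?f \<theta>"
      using that bs p_le[of \<theta>] by (intro mult_nonneg_nonneg) auto
    then show ?thesis
      using lambda_ge[OF that(2)] by (rule order.trans)
  qed
  have phi_inf: "phi_inf i \<delta> a \<omega> g b \<theta> = curve_offset i \<delta> a - sgn_idx i * b * ?m \<theta>
      - sgn_idx i * orbit_inf A \<Omega> (\<lambda>\<theta>. c - b * p \<theta>) \<theta>" if "0 \<le> b" "b \<le> bs" for b \<theta>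
    using phi_inf_eq[OF system that(1)] lambda_nonneg[OF that]
    by (simp add: lambda0 mu A_def \<Omega>_def)

  define K where "K = \<bar>\<Sum>k. Kg / \<bar>a\<bar> ^ Suc k\<bar>"
  have K: "\<bar>?m x - ?m y\<bar> \<le> K * \<bar>x - y\<bar>" for x y
    using order.trans[OF twisted_sum_lipschitz[OF a per cont Kg(2)] mult_right_mono[OF abs_ge_self abs_ge_zero]]
    unfolding K_def by blast
  have "K \<ge> 0"
    by (simp add: K_def)
  obtain u v where uv: "u < v" "{u..v} \<subseteq> I"
  proof -
    obtain x y where "x \<in> I" "y \<in> I" "x < y"
      using assms(13) by (metis linorder_neqE)
    then show ?thesis
      using that assms(12) unfolding is_interval_1 by (metis atLeastAtMost_iff subsetI)
  qed
  \<comment> \<open>The margins on both sides of \<open>{s..t}\<close> keep points close to \<theta>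
    inside \<open>I\<close>.\<close>
  obtain s t where st: "u < s" "s < t" "t < v"
    using dense[OF uv(1)] dense by blast
  obtain \<theta> \<eta> where \<theta>: "\<theta> \<in> {s..t}" and \<eta>: "\<eta> > 0"
    and grow: "\<And>k. \<eta> \<le> A ^ k * ?f (\<theta> - real k * \<Omega>)"
    using orbit_growth_dominates[OF per_f cont_f _ ord A st(2)] p_le
    by auto

  have "\<forall>\<^sub>F b in at_left bs. ennreal l < lip_const_on I (phi_inf i \<delta> a \<omega> g b)" if "l \<ge> 0" for l
  proof -
    \<comment> \<open>\<open>l\<close> is the slope to be exceeded, \<open>bs * K\<close> bounds the
      slope of the \<open>mu\<close> part, and 1 makes \<open>M\<close> positive.\<close>
    define M where "M = l + bs * K + 1"
    have M: "M > 0"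
      using that bs \<open>K \<ge> 0\<close> by (auto simp: M_def intro!: add_nonneg_pos)
    \<comment> \<open>The last bound gives \<open>M * \<bar>\<theta> - y\<bar> < \<eta> / 4\<close>,
      the difference between the lower bound \<open>\<eta> / 2\<close> at \<theta> and the upper
      bound \<open>\<eta> / 4\<close> at \<open>y\<close>.\<close>
    define d where "d = min (min (s - u) (v - t)) (\<eta> / (4 * M))"
    have "d > 0"
      using st \<eta> M by (simp add: d_def)
    then obtain k j where kj: "\<bar>z + real k * \<Omega> + 2 * pi * of_int j - \<theta>\<bar> < d"
      using circle_orbit_dense[OF \<Omega>] by metis
    \<comment> \<open>Modulo \<open>2 * pi\<close>, \<open>y\<close> is the \<open>k\<close>-th
      forward image of the zero \<open>z\<close>, so the \<open>k\<close>-th term of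
      \<open>orbit_inf\<close> at \<open>y\<close> is \<open>A ^ k * (c - b * p z)\<close>. With
      \<open>k\<close> fixed before \<open>b\<close>, it tends to 0 as \<open>b\<close> tends to
      \<open>bs\<close>.\<close>
    define y where "y = z + real k * \<Omega> + 2 * pi * of_int j"
    have y: "\<bar>\<theta> - y\<bar> < s - u" "\<bar>\<theta> - y\<bar> < v - t" "\<bar>\<theta> - y\<bar> < \<eta> / (4 * M)"
      using kj by (auto simp: y_def d_def abs_minus_commute)
    have mem: "\<theta> \<in> I" "y \<in> I"
      using \<theta> st y(1,2) by (auto simp: abs_less_iff intro!: subsetD[OF uv(2)])
    have "((\<lambda>b. A ^ k * (c - b * p z)) \<longlongrightarrow> A ^ k * (c - bs * p z)) (at_left bs)"
      by (intro tendsto_intros)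
    then have "\<forall>\<^sub>F b in at_left bs. A ^ k * (c - b * p z) < \<eta> / 4"
      by (rule order_tendstoD(2)) (use z \<eta> in simp)
    \<comment> \<open>Beyond \<open>bs / 2\<close> the factor \<open>b / bs\<close> costs at most
      half of \<eta>.\<close>
    moreover have "\<forall>\<^sub>F b in at_left bs. b \<in> {bs / 2<..<bs}"
      by (rule eventually_at_left_real) (use bs in simp)
    ultimately show ?thesis
    proof eventually_elim
      case (elim b)
      then have b: "0 \<le> b" "b \<le> bs" "b / bs \<ge> 1 / 2"
        using bs by (auto simp: field_simps)
      let ?O = "orbit_inf A \<Omega> (\<lambda>\<theta>. c - b * p \<theta>)"
      have "?O y \<le> A ^ k * (c - b * p (y - real k * \<Omega>))"
        using A lambda_nonneg[OF b(1,2)] by (intro orbit_inf_le) auto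
      also have "y - real k * \<Omega> = z + 2 * pi * of_int j"
        by (simp add: y_def)
      also have "p (z + 2 * pi * of_int j) = p z"
        by (rule circle_fun_shift_int[OF per_p])
      finally have small: "?O y < \<eta> / 4"
        using elim by linarith
      have large: "\<eta> / 2 \<le> ?O \<theta>"
      proof (rule orbit_inf_ge)
        fix n
        have "\<eta> / 2 \<le> b / bs * \<eta>"
          using b(3) \<eta> mult_right_mono[of "1 / 2" "b / bs" \<eta>] by simp
        also have "\<dots> \<le> b / bs * (A ^ n * ?f (\<theta> - real n * \<Omega>))"
          using grow[of n] b bs by (intro mult_left_mono) auto
        also have "\<dots> = A ^ n * (b / bs * ?f (\<theta> - real n * \<Omega>))"
          by simp
        also have "\<dots> \<le> A ^ n * (c - b * p (\<theta> - real n * \<Omega>))"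
          using A lambda_ge[OF b(2)] by (intro mult_left_mono) auto
        finally show "\<eta> / 2 \<le> A ^ n * (c - b * p (\<theta> - real n * \<Omega>))" .
      qed
      have "\<theta> \<noteq> y"
        using small large \<eta> by auto
      have "M * \<bar>\<theta> - y\<bar> < \<eta> / 4"
        using y(3) M by (simp add: field_simps)
      then have "M * \<bar>\<theta> - y\<bar> < ?O \<theta> - ?O y"
        using small large by linarith
      moreover have "b * \<bar>?m \<theta> - ?m y\<bar> \<le> bs * (K * \<bar>\<theta> - y\<bar>)"
        using b bs K by (intro mult_mono) auto
      \<comment> \<open>\<open>sgn_idx i\<close> is a sign common to both parts and disappears in
        the absolute value.\<close>
      moreover have "\<bar>phi_inf i \<delta> a \<omega> g b \<theta> - phi_inf i \<delta> a \<omega> g b y\<bar>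
          = \<bar>b * (?m \<theta> - ?m y) + (?O \<theta> - ?O y)\<bar>"
        unfolding phi_inf[OF b(1,2)] by (auto simp: sgn_idx_def algebra_simps)
      moreover have "\<bar>b * (?m \<theta> - ?m y)\<bar> = b * \<bar>?m \<theta> - ?m y\<bar>"
        using b(1) by (simp add: abs_mult)
      moreover have "l * \<bar>\<theta> - y\<bar> \<le> M * \<bar>\<theta> - y\<bar> - bs * (K * \<bar>\<theta> - y\<bar>)"
        by (simp add: M_def algebra_simps)
      ultimately have "l * \<bar>\<theta> - y\<bar> < \<bar>phi_inf i \<delta> a \<omega> g b \<theta> - phi_inf i \<delta> a \<omega> g b y\<bar>"
        by linarith
      then have "l < \<bar>phi_inf i \<delta> a \<omega> g b \<theta> - phi_inf i \<delta> a \<omega> g b y\<bar> / \<bar>\<theta> - y\<bar>"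
        using \<open>\<theta> \<noteq> y\<close> by (simp add: pos_less_divide_eq)
      then have "ennreal l < ennreal (\<bar>phi_inf i \<delta> a \<omega> g b \<theta> - phi_inf i \<delta> a \<omega> g b y\<bar> / \<bar>\<theta> - y\<bar>)"
        using that by (intro ennreal_lessI) auto
      also have "\<dots> \<le> lip_const_on I (phi_inf i \<delta> a \<omega> g b)"
        unfolding lip_const_on_def using mem \<open>\<theta> \<noteq> y\<close>
        by (intro SUP_upper2[of "(\<theta>, y)"]) auto
      finally show ?case .
    qed
  qed
  then have "((\<lambda>b. lip_const_on I (phi_inf i \<delta> a \<omega> g b)) \<longlongrightarrow> \<infinity>) (at_left bs)"
    by (simp add: tendsto_top_iff_ennreal infinity_ennreal_def)
  then show ?thesis
    by (intro lim_imp_Limsup) auto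
qed

end
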